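(* Let $k_1,k_2\in\mathbb{N}$ be fixed with $k_1<k_2$, let $p\in[1,\infty)$, and for each integer $n\ge k_2$ let $X_p^{(n)}\sim\mu_p^{(n)}$ be a random vector in $\mathbb{R}^n$. Then the Maclaurin ratio $\mathscr{R}^{(n)}_{k_1,k_2,p}=\mathscr{R}^{(n)}_{k_1,k_2,p}(X_p^{(n)})$ satisfies $$\sqrt{n}\left(\frac{np}{k_2-k_1}\bigl(\mathscr{R}^{(n)}_{k_1,k_2,p}-1\bigr)+\frac{p}{2}\right)\xrightarrow[n\to\infty]{\mathrm{d}}Z,$$ where $Z\sim\mathcal{N}(0,\rho_p^2)$.
   Context: For $x\in\mathbb{R}^n$ and $p\in[1,\infty)$ let $\|x\|_p=(\sum_{i=1}^n|x_i|^p)^{1/p}$, $\mathbb{B}_p^n=\{x\in\mathbb{R}^n:\|x\|_p\le1\}$, $\mathbb{S}_p^{n-1}=\{x\in\mathbb{R}^n:\|x\|_p=1\}$. Cone measure: $\mu_p^{(n)}(A)=\lambda^{(n)}(\{ra:r\in[0,1],a\in A\})/\lambda^{(n)}(\mathbb{B}_p^n)$ for Borel $A\subset\mathbb{S}_p^{n-1}$, with $\lambda^{(n)}$ Lebesgue measure. For $x\in\mathbb{R}^n$ and $1\le k\le n$ let $$S^{(n)}_{k,p}(x)=\Bigl(\tbinom{n}{k}^{-1}\sum_{1\le i_1<\dots<i_k\le n}|x_{i_1}|^p\cdots|x_{i_k}|^p\Bigr)^{1/(kp)},$$ and for $1\le k_1<k_2\le n$ let $\mathscr{R}^{(n)}_{k_1,k_2,p}(x)=S^{(n)}_{k_2,p}(x)/S^{(n)}_{k_1,p}(x)$.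 The $p$-Gaussian distribution has Lebesgue density $x\mapsto \frac{1}{2p^{1/p}\Gamma(1+1/p)}\mathrm{e}^{-|x|^p/p}$ on $\mathbb{R}$. For $X$ a $p$-Gaussian random variable, $\rho_p^2=\tfrac14\operatorname{Var}\bigl[(|X|^p-1-p)^2\bigr]$. $\xrightarrow{\mathrm{d}}$ denotes convergence in distribution. *)

theory Defs
  imports "HOL-Probability.Probability"
begin

text \<open>
  Since the dimension tends to infinity, R^n is modelled as the product space over the index set
  \<open>{..<n}\<close>; its points are functions that are \<^const>\<open>undefined\<close> outside \<open>{..<n}\<close>.  The sets of
  \<open>lborel_n n\<close> are the Borel sets of R^n and its measure is n-dimensional Lebesgue measure.
\<close>

definition lborel_n :: "nat \<Rightarrow> (nat \<Rightarrow> real) measure" where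
  "lborel_n n = (\<Pi>\<^sub>M i\<in>{..<n}. lborel)"

definition lp_norm :: "real \<Rightarrow> nat \<Rightarrow> (nat \<Rightarrow> real) \<Rightarrow> real" where
  "lp_norm p n x = (\<Sum>i<n. \<bar>x i\<bar> powr p) powr (1 / p)"

definition lp_ball :: "real \<Rightarrow> nat \<Rightarrow> (nat \<Rightarrow> real) set" where
  "lp_ball p n = {x \<in> space (lborel_n n). lp_norm p n x \<le> 1}"

definition lp_sphere :: "real \<Rightarrow> nat \<Rightarrow> (nat \<Rightarrow> real) set" where
  "lp_sphere p n = {x \<in> space (lborel_n n). lp_norm p n x = 1}"

definition cone_over :: "nat \<Rightarrow> (nat \<Rightarrow> real) set \<Rightarrow> (nat \<Rightarrow> real) set" where
  "cone_over n A = {\<lambda>i\<in>{..<n}. r * a i | r a. r \<in> {0..1} \<and> a \<in> A}"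

text \<open>
  The cone measure is regarded as a Borel measure on R^n that is concentrated on the sphere.
  The set function below is countably additive on the Borel sets
  (lemma \<open>emeasure_cone_measure\<close>), so \<^const>\<open>measure_of\<close> does not collapse to the zero measure.
\<close>

definition cone_measure :: "real \<Rightarrow> nat \<Rightarrow> (nat \<Rightarrow> real) measure" where
  "cone_measure p n = measure_of (space (lborel_n n)) (sets (lborel_n n))
     (\<lambda>A. emeasure (lborel_n n) (cone_over n (A \<inter> lp_sphere p n)) /
          emeasure (lborel_n n) (lp_ball p n))"

definition maclaurin_mean :: "nat \<Rightarrow> real \<Rightarrow> nat \<Rightarrow> (nat \<Rightarrow> real) \<Rightarrow> real" where
  "maclaurin_mean k p n x =
     ((\<Sum>I | I \<subseteq> {..<n} \<and> card I = k. \<Prod>i\<in>I. \<bar>x i\<bar> powr p) / real (n choose k))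
       powr (1 / (real k * p))"

definition maclaurin_ratio :: "nat \<Rightarrow> nat \<Rightarrow> real \<Rightarrow> nat \<Rightarrow> (nat \<Rightarrow> real) \<Rightarrow> real" where
  "maclaurin_ratio k1 k2 p n x = maclaurin_mean k2 p n x / maclaurin_mean k1 p n x"

definition p_gaussian_density :: "real \<Rightarrow> real \<Rightarrow> real" where
  "p_gaussian_density p x =
     1 / (2 * p powr (1 / p) * Gamma (1 + 1 / p)) * exp (- (\<bar>x\<bar> powr p) / p)"

definition p_gaussian :: "real \<Rightarrow> real measure" where
  "p_gaussian p = density lborel (p_gaussian_density p)"

definition rho_sq :: "real \<Rightarrow> real" where
  "rho_sq p = 1 / 4 * prob_space.variance (p_gaussian p) (\<lambda>x. (\<bar>x\<bar> powr p - 1 - p)\<^sup>2)"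

subsection \<open>The cone measure is a probability measure\<close>

lemma sets_lborel_n: "sets (lborel_n n) = sets (\<Pi>\<^sub>M i\<in>{..<n}. borel)"
  unfolding lborel_n_def by (intro sets_PiM_cong) auto

lemma space_lborel_n: "space (lborel_n n) = {..<n} \<rightarrow>\<^sub>E UNIV"
  by (simp add: lborel_n_def space_PiM)

lemma lp_norm_measurable [measurable]: "lp_norm p n \<in> borel_measurable (lborel_n n)"
proof -
  have [measurable]: "(\<lambda>x. x i) \<in> borel_measurable (lborel_n n)" if "i \<in> {..<n}" for i
    using measurable_component_singleton[OF that, of "\<lambda>_. lborel"] by (simp add: lborel_n_def)
  show ?thesis unfolding lp_norm_def[abs_def] by measurable
qed

lemma lp_ball_sets [measurable]: "lp_ball p n \<in> sets (lborel_n n)"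
  unfolding lp_ball_def by measurable

lemma lp_norm_nonneg: "lp_norm p n x \<ge> 0"
  by (simp add: lp_norm_def)

lemma lp_norm_cmult:
  assumes "p \<ge> 1"
  shows "lp_norm p n (\<lambda>i\<in>{..<n}. c * x i) = \<bar>c\<bar> * lp_norm p n x"
proof -
  have "(\<Sum>i<n. \<bar>(\<lambda>i\<in>{..<n}. c * x i) i\<bar> powr p) = \<bar>c\<bar> powr p * (\<Sum>i<n. \<bar>x i\<bar> powr p)"
    by (simp add: sum_distrib_left abs_mult powr_mult)
  then show ?thesis
    using assms by (simp add: lp_norm_def powr_mult sum_nonneg powr_powr)
qed

lemma lp_norm_eq_0D:
  assumes "lp_norm p n x = 0" "i < n"
  shows "x i = 0"
proof -
  have "(\<Sum>i<n. \<bar>x i\<bar> powr p) = 0" using assms(1) by (simp add: lp_norm_def)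
  then have "\<bar>x i\<bar> powr p = 0"
    using assms(2) by (subst (asm) sum_nonneg_eq_0_iff) auto
  then show ?thesis by simp
qed

definition lp_normalize :: "real \<Rightarrow> nat \<Rightarrow> (nat \<Rightarrow> real) \<Rightarrow> nat \<Rightarrow> real" where
  "lp_normalize p n x = (\<lambda>i\<in>{..<n}. x i / lp_norm p n x)"

lemma lp_normalize_measurable [measurable]:
  "lp_normalize p n \<in> measurable (lborel_n n) (lborel_n n)"
proof -
  have [measurable]: "(\<lambda>x. x i) \<in> borel_measurable (lborel_n n)" if "i \<in> {..<n}" for i
    using measurable_component_singleton[OF that, of "\<lambda>_. lborel"] by (simp add: lborel_n_def)
  have "lp_normalize p n \<in> measurable (lborel_n n) (\<Pi>\<^sub>M i\<in>{..<n}. lborel)"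
    unfolding lp_normalize_def[abs_def] by (rule measurable_restrict) measurable
  then show ?thesis by (simp add: lborel_n_def)
qed

lemma cone_over_sphere:
  assumes "p \<ge> 1"
  shows "cone_over n (A \<inter> lp_sphere p n) - {\<lambda>i\<in>{..<n}. 0} =
         (lp_normalize p n -` A \<inter> lp_ball p n) - {\<lambda>i\<in>{..<n}. 0}"
proof (intro equalityI subsetI)
  fix x assume "x \<in> cone_over n (A \<inter> lp_sphere p n) - {\<lambda>i\<in>{..<n}. 0}"
  then obtain r a where r: "0 \<le> r" "r \<le> 1" and a: "a \<in> A" "a \<in> lp_sphere p n"
    and x: "x = (\<lambda>i\<in>{..<n}. r * a i)" and x0: "x \<noteq> (\<lambda>i\<in>{..<n}. 0)"
    unfolding cone_over_def by auto
  from x x0 have "r \<noteq> 0" by (auto simp: restrict_def)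
  have nx: "lp_norm p n x = r"
    using lp_norm_cmult[OF assms, of n r a] a r by (simp add: x lp_sphere_def)
  have "a \<in> extensional {..<n}"
    using a by (auto simp: lp_sphere_def space_lborel_n PiE_def)
  then have "lp_normalize p n x = a"
    using \<open>r \<noteq> 0\<close> unfolding lp_normalize_def nx
    by (auto simp: x restrict_def fun_eq_iff extensional_def)
  then show "x \<in> (lp_normalize p n -` A \<inter> lp_ball p n) - {\<lambda>i\<in>{..<n}. 0}"
    using a x0 nx r by (auto simp: lp_ball_def space_lborel_n x)
next
  fix x assume "x \<in> (lp_normalize p n -` A \<inter> lp_ball p n) - {\<lambda>i\<in>{..<n}. 0}"
  then have xA: "lp_normalize p n x \<in> A" and xs: "x \<in> extensional {..<n}"
    and x1: "lp_norm p n x \<le> 1" and x0: "x \<noteq> (\<lambda>i\<in>{..<n}. 0)"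
    by (auto simp: lp_ball_def space_lborel_n PiE_def)
  have nz: "lp_norm p n x \<noteq> 0"
  proof
    assume "lp_norm p n x = 0"
    with lp_norm_eq_0D xs have "x = (\<lambda>i\<in>{..<n}. 0)"
      by (auto simp: fun_eq_iff extensional_def restrict_def)
    with x0 show False by simp
  qed
  have "lp_norm p n (lp_normalize p n x) = 1"
    using lp_norm_cmult[OF assms, of n "1 / lp_norm p n x" x] nz lp_norm_nonneg[of p n x]
    by (simp add: lp_normalize_def)
  then have "lp_normalize p n x \<in> lp_sphere p n"
    by (auto simp: lp_sphere_def space_lborel_n lp_normalize_def)
  moreover have "x = (\<lambda>i\<in>{..<n}. lp_norm p n x * lp_normalize p n x i)"
    using nz xs by (auto simp: lp_normalize_def fun_eq_iff restrict_def extensional_def)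
  ultimately show "x \<in> cone_over n (A \<inter> lp_sphere p n) - {\<lambda>i\<in>{..<n}. 0}"
    unfolding cone_over_def using xA x1 x0 lp_norm_nonneg[of p n x] by auto
qed

lemma emeasure_lborel_n_box:
  assumes "a \<le> b"
  shows "emeasure (lborel_n n) ({..<n} \<rightarrow>\<^sub>E {a..b}) = ennreal (b - a) ^ n"
proof -
  interpret product_sigma_finite "\<lambda>_::nat. lborel :: real measure" ..
  show ?thesis
    unfolding lborel_n_def using assms by (subst emeasure_PiM) auto
qed

lemma emeasure_lborel_n_zero:
  assumes "n \<ge> 1"
  shows "{\<lambda>i\<in>{..<n}. 0} \<in> null_sets (lborel_n n)"
proof -
  have eq: "{\<lambda>i\<in>{..<n}. 0} = ({..<n} \<rightarrow>\<^sub>E {0..0::real})"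
    by (auto simp: PiE_def extensional_def restrict_def fun_eq_iff Pi_def)
  have "({..<n} \<rightarrow>\<^sub>E {0..0::real}) \<in> sets (lborel_n n)"
    unfolding lborel_n_def by (intro sets_PiM_I_finite) auto
  then show ?thesis
    using emeasure_lborel_n_box[of 0 0 n] assms by (simp only: eq) auto
qed

lemma emeasure_cone_over:
  assumes "p \<ge> 1" "n \<ge> 1" and A [measurable]: "A \<in> sets (lborel_n n)"
  shows "emeasure (lborel_n n) (cone_over n (A \<inter> lp_sphere p n)) =
         emeasure (lborel_n n) (lp_normalize p n -` A \<inter> lp_ball p n)"
proof -
  let ?z = "{\<lambda>i\<in>{..<n}. 0::real}" and ?C = "cone_over n (A \<inter> lp_sphere p n)"
  let ?N = "lp_normalize p n -` A \<inter> lp_ball p n"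
  have z [measurable]: "?z \<in> sets (lborel_n n)" and zn: "?z \<in> null_sets (lborel_n n)"
    using emeasure_lborel_n_zero[OF assms(2)] by auto
  have "?N = (lp_normalize p n -` A \<inter> space (lborel_n n)) \<inter> lp_ball p n"
    by (auto simp: lp_ball_def)
  then have N [measurable]: "?N \<in> sets (lborel_n n)"
    by simp
  have "?C = (?C - ?z) \<union> (?C \<inter> ?z)" by blast
  moreover have "?C \<inter> ?z = {} \<or> ?C \<inter> ?z = ?z" by blast
  moreover have "?C - ?z \<in> sets (lborel_n n)"
    unfolding cone_over_sphere[OF assms(1)] by measurable
  ultimately have C: "?C \<in> sets (lborel_n n)"
    using z by (metis sets.Un sets.empty_sets)
  have "emeasure (lborel_n n) ?C = emeasure (lborel_n n) (?C - ?z)"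
    using emeasure_Diff_null_set[OF zn C] by simp
  also have "\<dots> = emeasure (lborel_n n) ?N"
    unfolding cone_over_sphere[OF assms(1)] using emeasure_Diff_null_set[OF zn N] by simp
  finally show ?thesis .
qed

lemma lp_ball_subset_box:
  assumes "p \<ge> 1"
  shows "lp_ball p n \<subseteq> {..<n} \<rightarrow>\<^sub>E {-1..1}"
proof
  fix x assume x: "x \<in> lp_ball p n"
  have "\<bar>x i\<bar> \<le> 1" if "i < n" for i
  proof -
    have "\<bar>x i\<bar> = (\<bar>x i\<bar> powr p) powr (1 / p)" using assms by (simp add: powr_powr)
    also have "\<dots> \<le> lp_norm p n x"
      unfolding lp_norm_def using assms that
      by (intro powr_mono2 member_le_sum) auto
    also have "\<dots> \<le> 1" using x by (simp add: lp_ball_def)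
    finally show ?thesis .
  qed
  then show "x \<in> {..<n} \<rightarrow>\<^sub>E {-1..1}"
    using x by (auto simp: lp_ball_def space_lborel_n PiE_def Pi_def abs_le_iff)
qed

lemma box_subset_lp_ball:
  assumes "p \<ge> 1" "n \<ge> 1"
  shows "({..<n} \<rightarrow>\<^sub>E {0..1 / real n}) \<subseteq> lp_ball p n"
proof
  fix x assume x: "x \<in> {..<n} \<rightarrow>\<^sub>E {0..1 / real n}"
  have "\<bar>x i\<bar> powr p \<le> 1 / real n" if "i < n" for i
  proof -
    have xi: "0 \<le> x i" "x i \<le> 1 / real n" using x that by (auto simp: PiE_def Pi_def)
    have "x i powr p \<le> x i"
    proof (cases "x i = 0")
      case False
      have "1 / real n \<le> 1" using assms(2) by simp
      with xi(2) have "x i \<le> 1" by (rule order_trans)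
      then have "x i powr p \<le> x i powr 1"
        using xi(1) assms(1) by (intro powr_mono') auto
      then show ?thesis using xi(1) by simp
    qed simp
    then show ?thesis using xi by simp
  qed
  then have "(\<Sum>i<n. \<bar>x i\<bar> powr p) \<le> (\<Sum>i<n. 1 / real n)" by (intro sum_mono) auto
  also have "\<dots> = 1" using assms by simp
  finally have "lp_norm p n x \<le> 1 powr (1 / p)"
    unfolding lp_norm_def using assms by (intro powr_mono2 sum_nonneg) auto
  then show "x \<in> lp_ball p n" using x by (auto simp: lp_ball_def space_lborel_n)
qed

lemma emeasure_lp_ball:
  assumes "p \<ge> 1" "n \<ge> 1"
  shows "emeasure (lborel_n n) (lp_ball p n) \<noteq> 0" "emeasure (lborel_n n) (lp_ball p n) \<noteq> \<infinity>"
proof -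
  have box: "({..<n} \<rightarrow>\<^sub>E {a..b::real}) \<in> sets (lborel_n n)" for a b
    unfolding lborel_n_def by (intro sets_PiM_I_finite) auto
  have "0 < ennreal (1 / real n) ^ n"
    using assms by (simp add: ennreal_power)
  also have "\<dots> = emeasure (lborel_n n) ({..<n} \<rightarrow>\<^sub>E {0..1 / real n})"
    using emeasure_lborel_n_box[of 0 "1 / real n" n] by simp
  also have "\<dots> \<le> emeasure (lborel_n n) (lp_ball p n)"
    by (intro emeasure_mono box_subset_lp_ball assms lp_ball_sets)
  finally show "emeasure (lborel_n n) (lp_ball p n) \<noteq> 0" by simp
  have "emeasure (lborel_n n) (lp_ball p n) \<le> emeasure (lborel_n n) ({..<n} \<rightarrow>\<^sub>E {-1..1})"
    by (intro emeasure_mono lp_ball_subset_box assms box)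
  also have "\<dots> = ennreal 2 ^ n"
    using emeasure_lborel_n_box[of "-1" 1 n] by simp
  also have "\<dots> = ennreal (2 ^ n)"
    by (simp only: ennreal_power)
  also have "\<dots> < \<infinity>" by simp
  finally show "emeasure (lborel_n n) (lp_ball p n) \<noteq> \<infinity>" by simp
qed

lemma cone_measure_eq_distr:
  assumes "p \<ge> 1" "n \<ge> 1"
  shows "cone_measure p n =
         distr (uniform_measure (lborel_n n) (lp_ball p n)) (lborel_n n) (lp_normalize p n)"
    (is "_ = ?D")
proof -
  have "emeasure (lborel_n n) (cone_over n (A \<inter> lp_sphere p n)) /
          emeasure (lborel_n n) (lp_ball p n) = emeasure ?D A"
    if A [measurable]: "A \<in> sets (lborel_n n)" for A
  proof -
    have "lp_normalize p n -` A \<inter> lp_ball p n =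
          lp_ball p n \<inter> (lp_normalize p n -` A \<inter> space (lborel_n n))"
      by (auto simp: lp_ball_def)
    then show ?thesis
      by (simp add: emeasure_cone_over[OF assms A] emeasure_distr)
  qed
  then have "cone_measure p n =
      measure_of (space (lborel_n n)) (sets (lborel_n n)) (emeasure ?D)"
    unfolding cone_measure_def
    by (intro measure_of_eq sets.space_closed) (simp add: sets.sigma_sets_eq)
  also have "\<dots> = ?D"
    using measure_of_of_measure[of ?D] by simp
  finally show ?thesis .
qed

lemma emeasure_cone_measure:
  assumes "p \<ge> 1" "n \<ge> 1" and A [measurable]: "A \<in> sets (lborel_n n)"
  shows "emeasure (cone_measure p n) A =
         emeasure (lborel_n n) (cone_over n (A \<inter> lp_sphere p n)) /
         emeasure (lborel_n n) (lp_ball p n)"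
proof -
  have "lp_normalize p n -` A \<inter> lp_ball p n =
        lp_ball p n \<inter> (lp_normalize p n -` A \<inter> space (lborel_n n))"
    by (auto simp: lp_ball_def)
  then show ?thesis
    by (simp add: cone_measure_eq_distr[OF assms(1,2)] emeasure_cone_over[OF assms] emeasure_distr)
qed

lemma prob_space_cone_measure:
  assumes "p \<ge> 1" "n \<ge> 1"
  shows "prob_space (cone_measure p n)"
proof -
  interpret U: prob_space "uniform_measure (lborel_n n) (lp_ball p n)"
    by (rule prob_space_uniform_measure) (use emeasure_lp_ball[OF assms] in auto)
  show ?thesis
    unfolding cone_measure_eq_distr[OF assms] by (rule U.prob_space_distr) simp
qed

end

theory Submission
  imports Defs "HOL-Real_Asymp.Real_Asymp"
begin

text \<open>
  If \<open>\<xi>\<^sub>1, \<xi>\<^sub>2, \<dots>\<close> are independent \<open>p\<close>-Gaussians, then \<open>\<xi> / \<parallel>\<xi>\<parallel>\<^sub>p\<close> has law \<open>\<mu>\<^sub>p\<close>.  Put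
  \<open>Y\<^sub>i = \<bar>\<xi>\<^sub>i\<bar>\<^sup>p\<close>, \<open>m = (\<Sum> Y\<^sub>i) / n\<close> and \<open>z\<^sub>i = Y\<^sub>i / m - 1\<close>, so that \<open>\<Sum> z\<^sub>i = 0\<close>.  Newton's identities then give
  \<open>e\<^sub>j(z) = O(n ^ (j div 2))\<close>; hence in the expansion of the normalised \<open>e\<^sub>k(1 + z)\<close> only the quadratic term
  survives up to \<open>O(1 / n\<^sup>2)\<close>, and it equals \<open>- k (k - 1) V / (2 n)\<close> with \<open>V = (\<Sum> z\<^sub>i\<^sup>2) / n\<close>.  Taking logarithms,
  the statistic of the theorem is \<open>- sqrt n (V - p) / 2 + O(1 / sqrt n)\<close>.  Since
  \<open>V = (\<Sum> Y\<^sub>i\<^sup>2) / (n m\<^sup>2) - 1\<close>, linearising at \<open>m = 1\<close> turns this into a normalised sum of the centred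
  variables \<open>- (Y\<^sub>i - 1 - p)\<^sup>2 / 2\<close>, to which the central limit theorem applies.
\<close>

subsection \<open>Elementary symmetric polynomials of centred variables\<close>

text \<open>The statistic magnifies the ratio by \<open>n sqrt n\<close>, so the logarithmic
  expansion must be exact up to \<open>o(n^(-3/2))\<close>, and an error \<open>O(1 / n^2)\<close>
  is enough. Centring at the empirical mean \<open>m\<close>, and not at the expectation 1, makes
  this possible: the first power sum vanishes exactly, hence in Newton's identities every factor
  \<open>n\<close> is paid for by at least two degrees. Dividing by a binomial coefficient of order
  \<open>n^j\<close> leaves \<open>n^(j div 2 - j)\<close>, which is at most \<open>n^(-2)\<close>
  from \<open>j = 3\<close> on. Randomness is kept out of this analysis. For fixed
  \<open>k1\<close>, \<open>k2\<close>, \<open>p\<close> the expansions are deterministic, with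
  constants and thresholds in \<open>n\<close> that depend only on a bound for certain sums,
  uniformly over all points that satisfy it. Probability enters through the inequalities of
  Chebyshev and Markov, which give this bound with probability close to one, and through the limit
  theorem for the linear part. The number \<open>p\<close> subtracted from \<open>V\<close> is its
  limit, since \<open>Y\<close> has mean 1 and second moment \<open>1 + p\<close>.\<close>

definition esym :: "'i set \<Rightarrow> ('i \<Rightarrow> real) \<Rightarrow> nat \<Rightarrow> real" where
  "esym A f k = (\<Sum>I | I \<subseteq> A \<and> card I = k. \<Prod>i\<in>I. f i)"

lemma esym_0 [simp]: "finite A \<Longrightarrow> esym A f 0 = 1"
proof -
  assume "finite A"
  then have "{I. I \<subseteq> A \<and> card I = 0} = {{}}"
    by (auto dest: finite_subset)
  then show ?thesis by (simp add: esym_def)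
qed

lemma esym_empty_Suc [simp]: "esym {} f (Suc k) = 0"
proof -
  have "{I. I \<subseteq> {} \<and> card I = Suc k} = ({} :: 'a set set)" by auto
  then show ?thesis unfolding esym_def by (simp only: sum.empty)
qed

text \<open>Index sets of size \<open>Suc k\<close> either avoid \<open>a\<close> or arise from a
  unique set of size \<open>k\<close> by inserting \<open>a\<close>. This recursion drives the
  induction for Newton's identities.\<close>

lemma esym_insert:
  assumes "finite A" "a \<notin> A"
  shows "esym (insert a A) f (Suc k) = esym A f (Suc k) + f a * esym A f k"
proof -
  have split: "{I. I \<subseteq> insert a A \<and> card I = Suc k} =
      {I. I \<subseteq> A \<and> card I = Suc k} \<union> insert a ` {I. I \<subseteq> A \<and> card I = k}"
    (is "?L = ?R1 \<union> ?R2")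
  proof (intro equalityI subsetI)
    fix I assume I: "I \<in> ?L"
    show "I \<in> ?R1 \<union> ?R2"
    proof (cases "a \<in> I")
      case True
      have "finite I" using I assms by (auto intro: finite_subset)
      then have "I - {a} \<in> {I. I \<subseteq> A \<and> card I = k}" using I True by auto
      moreover have "I = insert a (I - {a})" using True by auto
      ultimately show ?thesis by blast
    qed (use I in auto)
  next
    fix I assume "I \<in> ?R1 \<union> ?R2"
    then show "I \<in> ?L"
    proof
      assume "I \<in> ?R2"
      then obtain J where J: "J \<subseteq> A" "card J = k" "I = insert a J" by auto
      have "finite J" "a \<notin> J" using J assms by (auto intro: finite_subset)
      then show ?thesis using J by auto
    qed auto
  qed
  have inj: "inj_on (insert a) {I. I \<subseteq> A \<and> card I = k}"
  proof (rule inj_onI)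
    fix I J assume "I \<in> {I. I \<subseteq> A \<and> card I = k}" "J \<in> {I. I \<subseteq> A \<and> card I = k}"
      and "insert a I = insert a J"
    then show "I = J" using assms(2) by (metis (mono_tags, lifting) insert_ident mem_Collect_eq subset_iff)
  qed
  have "esym (insert a A) f (Suc k) = (\<Sum>I\<in>?R1. \<Prod>i\<in>I. f i) + (\<Sum>I\<in>?R2. \<Prod>i\<in>I. f i)"
    unfolding esym_def split
    by (rule sum.union_disjoint) (use assms in auto)
  also have "(\<Sum>I\<in>?R2. \<Prod>i\<in>I. f i) = (\<Sum>I | I \<subseteq> A \<and> card I = k. f a * (\<Prod>i\<in>I. f i))"
    unfolding sum.reindex[OF inj] comp_def
  proof (rule sum.cong[OF refl])
    fix I assume I: "I \<in> {I. I \<subseteq> A \<and> card I = k}"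
    then have "finite I" "a \<notin> I" using assms by (auto intro: finite_subset)
    then show "(\<Prod>i\<in>insert a I. f i) = f a * (\<Prod>i\<in>I. f i)" by simp
  qed
  finally show ?thesis by (simp add: esym_def sum_distrib_left)
qed

text \<open>Induction on \<open>A\<close>. The mixed contributions of the new element telescope to
  \<open>f a * e m\<close>; the hypothesis at the next lower degree supplies
  \<open>f a * m * e m\<close>, and together they complete \<open>Suc m\<close> times the recursion
  \<open>esym_insert\<close>.\<close>

lemma newton_identity:
  assumes "finite A"
  shows "real (Suc m) * esym A f (Suc m) =
         (\<Sum>i\<le>m. (-1) ^ i * esym A f (m - i) * (\<Sum>a\<in>A. f a ^ Suc i))"
  using assms
proof (induction A arbitrary: m)
  case empty
  then show ?case by simp
next
  case (insert a A)
  have fin: "finite (insert a A)" using insert by simp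
  note rec = esym_insert[OF insert.hyps, of f]
  define e where "e = esym A f"
  define P where "P i = (\<Sum>b\<in>A. f b ^ Suc i)" for i
  have e0: "e 0 = 1" using insert by (simp add: e_def)
  show ?case
  proof (cases m)
    case 0
    then show ?thesis using rec[of 0] insert insert.IH[of 0] fin by simp
  next
    case (Suc l)
    have IH: "real (Suc q) * e (Suc q) = (\<Sum>i\<le>q. (-1) ^ i * e (q - i) * P i)" for q
      using insert.IH[of q] by (simp add: e_def P_def)
    \<comment> \<open>\<open>g\<close> collects the products of an old symmetric polynomial with a
      power of \<open>f a\<close>. The products that come from \<open>f a * e (l - i)\<close> are
      \<open>- g (Suc i)\<close>, so only \<open>g 0\<close> survives.\<close>
    define g where "g i = (-1) ^ i * e (m - i) * f a ^ Suc i" for i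
    have "(\<Sum>i\<le>m. (-1) ^ i * esym (insert a A) f (m - i) * (\<Sum>b\<in>insert a A. f b ^ Suc i))
        = (\<Sum>i\<le>l. (-1) ^ i * (e (m - i) + f a * e (l - i)) * (P i + f a ^ Suc i)) +
          (-1) ^ m * (P m + f a ^ Suc m)"
    proof -
      have 1: "(\<Sum>b\<in>insert a A. f b ^ Suc i) = P i + f a ^ Suc i" for i
        using insert by (simp add: P_def)
      have 2: "esym (insert a A) f (m - i) = e (m - i) + f a * e (l - i)" if "i \<le> l" for i
        using rec[of "l - i"] that Suc by (simp add: e_def Suc_diff_le)
      show ?thesis
        unfolding 1 using fin by (simp add: Suc 2[unfolded Suc])
    qed
    also have "\<dots> = (\<Sum>i\<le>l. (-1) ^ i * e (m - i) * P i) + (-1) ^ m * P m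
        + f a * (\<Sum>i\<le>l. (-1) ^ i * e (l - i) * P i)
        + ((\<Sum>i\<le>l. g i) + (-1) ^ m * f a ^ Suc m)
        - (\<Sum>i\<le>l. g (Suc i))"
      unfolding g_def using Suc
      by (simp add: algebra_simps sum.distrib sum_distrib_left sum_negf flip: sum_subtractf)
    also have "(\<Sum>i\<le>l. g i) + (-1) ^ m * f a ^ Suc m = (\<Sum>i\<le>m. g i)"
      by (simp add: Suc g_def e0)
    also have "(\<Sum>i\<le>m. g i) = g 0 + (\<Sum>i\<le>l. g (Suc i))"
      unfolding Suc by (rule sum.atMost_Suc_shift)
    also have "(\<Sum>i\<le>l. (-1) ^ i * e (m - i) * P i) + (-1) ^ m * P m = real (Suc m) * e (Suc m)"
      unfolding IH by (simp add: Suc e0)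
    also have "(\<Sum>i\<le>l. (-1) ^ i * e (l - i) * P i) = real m * e m"
      using IH[of l] Suc by simp
    finally show ?thesis
      using rec[of m] by (simp add: g_def e_def algebra_simps)
  qed
qed

text \<open>Removing \<open>J\<close> is a bijection onto the subsets of \<open>A - J\<close> of the
  complementary size. The count becomes the coefficient in \<open>esym_one_plus\<close>.\<close>

lemma card_supersets:
  assumes "finite A" "J \<subseteq> A" "card J \<le> k"
  shows "card {I. J \<subseteq> I \<and> I \<subseteq> A \<and> card I = k} = (card A - card J) choose (k - card J)"
proof -
  have fJ: "finite J" using assms by (auto intro: finite_subset)
  have "bij_betw (\<lambda>I. I - J) {I. J \<subseteq> I \<and> I \<subseteq> A \<and> card I = k} {K. K \<subseteq> A - J \<and> card K = k - card J}"
  proof (rule bij_betwI[where g = "\<lambda>K. K \<union> J"])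
    show "(\<lambda>K. K \<union> J) \<in> {K. K \<subseteq> A - J \<and> card K = k - card J} \<rightarrow> {I. J \<subseteq> I \<and> I \<subseteq> A \<and> card I = k}"
    proof
      fix K assume K: "K \<in> {K. K \<subseteq> A - J \<and> card K = k - card J}"
      then have "finite K" "K \<inter> J = {}" using assms by (auto intro: finite_subset)
      then show "K \<union> J \<in> {I. J \<subseteq> I \<and> I \<subseteq> A \<and> card I = k}"
        using K assms fJ by (auto simp: card_Un_disjoint)
    qed
    show "(\<lambda>I. I - J) \<in> {I. J \<subseteq> I \<and> I \<subseteq> A \<and> card I = k} \<rightarrow> {K. K \<subseteq> A - J \<and> card K = k - card J}"
      using fJ by (auto simp: card_Diff_subset)
  qed auto
  then have "card {I. J \<subseteq> I \<and> I \<subseteq> A \<and> card I = k} = card {K. K \<subseteq> A - J \<and> card K = k - card J}"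
    by (rule bij_betw_same_card)
  also have "\<dots> = card (A - J) choose (k - card J)"
    using assms by (intro n_subsets) auto
  finally show ?thesis using assms fJ by (simp add: card_Diff_subset)
qed

text \<open>Expand each product over subsets \<open>J\<close> of \<open>I\<close>, exchange the two
  sums and count how many index sets \<open>I\<close> contain a given \<open>J\<close>.\<close>

lemma esym_one_plus:
  assumes "finite A"
  shows "esym A (\<lambda>i. 1 + f i) k = (\<Sum>j\<le>k. real ((card A - j) choose (k - j)) * esym A f j)"
proof -
  let ?K = "{I. I \<subseteq> A \<and> card I = k}" and ?S = "{J. J \<subseteq> A \<and> card J \<le> k}"
  have fin: "finite ?K" "finite ?S" using assms by auto
  have "esym A (\<lambda>i. 1 + f i) k = (\<Sum>I\<in>?K. \<Sum>J\<in>Pow I. \<Prod>i\<in>J. f i)"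
    unfolding esym_def
  proof (rule sum.cong[OF refl])
    fix I assume "I \<in> ?K"
    then have "finite I" using assms by (auto intro: finite_subset)
    then have "(\<Prod>i\<in>I. f i + 1) = (\<Sum>J\<in>Pow I. (\<Prod>i\<in>J. f i) * (\<Prod>i\<in>I - J. 1))"
      by (rule prod_add)
    then show "(\<Prod>i\<in>I. 1 + f i) = (\<Sum>J\<in>Pow I. \<Prod>i\<in>J. f i)" by (simp add: add.commute)
  qed
  also have "\<dots> = (\<Sum>I\<in>?K. \<Sum>J\<in>{J\<in>?S. J \<subseteq> I}. \<Prod>i\<in>J. f i)"
  proof (rule sum.cong[OF refl])
    fix I assume "I \<in> ?K"
    then have "Pow I = {J\<in>?S. J \<subseteq> I}" using assms
      by (auto intro: card_mono finite_subset)
    then show "(\<Sum>J\<in>Pow I. \<Prod>i\<in>J. f i) = (\<Sum>J\<in>{J\<in>?S. J \<subseteq> I}. \<Prod>i\<in>J. f i)" by simp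
  qed
  also have "\<dots> = (\<Sum>J\<in>?S. \<Sum>I\<in>{I\<in>?K. J \<subseteq> I}. \<Prod>i\<in>J. f i)"
    by (rule sum.swap_restrict[OF fin])
  also have "\<dots> = (\<Sum>J\<in>?S. real ((card A - card J) choose (k - card J)) * (\<Prod>i\<in>J. f i))"
  proof (rule sum.cong[OF refl])
    fix J assume "J \<in> ?S"
    moreover have "{I\<in>?K. J \<subseteq> I} = {I. J \<subseteq> I \<and> I \<subseteq> A \<and> card I = k}" by auto
    ultimately show "(\<Sum>I\<in>{I\<in>?K. J \<subseteq> I}. \<Prod>i\<in>J. f i) =
        real ((card A - card J) choose (k - card J)) * (\<Prod>i\<in>J. f i)"
      using card_supersets[OF assms, of J k] by simp
  qed
  also have "\<dots> = (\<Sum>j\<le>k. \<Sum>J\<in>{J\<in>?S. card J = j}.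
      real ((card A - card J) choose (k - card J)) * (\<Prod>i\<in>J. f i))"
    by (rule sum.group[symmetric]) (use fin in auto)
  also have "\<dots> = (\<Sum>j\<le>k. real ((card A - j) choose (k - j)) * esym A f j)"
    unfolding esym_def sum_distrib_left
    by (rule sum.cong[OF refl], rule sum.cong) auto
  finally show ?thesis .
qed

section \<open>Asymptotics of symmetric means of centred data\<close>

text \<open>The interface between the deterministic and the random part: the expansions use no other
  information on the size of the data, and it holds outside an event of small probability.\<close>

definition moments_bdd :: "real \<Rightarrow> nat \<Rightarrow> nat \<Rightarrow> (nat \<Rightarrow> real) \<Rightarrow> bool" where
  "moments_bdd C k n z \<longleftrightarrow> (\<Sum>i<n. z i) = 0 \<and> (\<forall>i\<in>{2..k}. \<bar>\<Sum>a<n. z a ^ i\<bar> \<le> C * real n)"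

text \<open>Strong induction by Newton's identities. The term \<open>i = 0\<close> vanishes by
  centring; every other term lowers the degree by at least two in exchange for one factor
  \<open>C * n\<close>. The factor \<open>Suc m\<close> on the left absorbs the number of terms on
  the right.\<close>

lemma esym_bound:
  assumes "finite A" and C: "1 \<le> C" and s0: "(\<Sum>a\<in>A. f a) = 0"
    and n: "1 \<le> card A"
    and p: "\<And>i. 2 \<le> i \<Longrightarrow> i \<le> k \<Longrightarrow> \<bar>\<Sum>a\<in>A. f a ^ i\<bar> \<le> C * real (card A)"
  shows "j \<le> k \<Longrightarrow> \<bar>esym A f j\<bar> \<le> C ^ j * real (card A) ^ (j div 2)"
proof (induction j rule: less_induct)
  case (less j)
  show ?case
  proof (cases j)
    case 0
    then show ?thesis using assms by simp
  next
    case (Suc m)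
    let ?n = "real (card A)"
    have n1: "1 \<le> ?n" using n by simp
    have term_le: "\<bar>(-1) ^ i * esym A f (m - i) * (\<Sum>a\<in>A. f a ^ Suc i)\<bar> \<le> C ^ j * ?n ^ (j div 2)"
      if "i \<le> m" for i
    proof (cases i)
      case 0
      then show ?thesis using s0 C by simp
    next
      case (Suc l)
      have 1: "\<bar>esym A f (m - i)\<bar> \<le> C ^ (m - i) * ?n ^ ((m - i) div 2)"
        using less \<open>j = Suc m\<close> by simp
      have 2: "\<bar>\<Sum>a\<in>A. f a ^ Suc i\<bar> \<le> C * ?n"
        using p[of "Suc i"] Suc that less.prems \<open>j = Suc m\<close> by simp
      have "\<bar>(-1) ^ i * esym A f (m - i) * (\<Sum>a\<in>A. f a ^ Suc i)\<bar>
          \<le> (C ^ (m - i) * ?n ^ ((m - i) div 2)) * (C * ?n)"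
        unfolding abs_mult power_abs abs_minus_cancel abs_one power_one mult_1
        by (intro mult_mono 1 2) (use C in auto)
      also have "\<dots> = C ^ Suc (m - i) * ?n ^ Suc ((m - i) div 2)" by simp
      \<comment> \<open>Since \<open>i \<ge> 1\<close>, the exponent
        \<open>Suc ((m - i) div 2)\<close> is at most \<open>Suc m div 2\<close>, which is
        \<open>j div 2\<close>.\<close>
      also have "\<dots> \<le> C ^ j * ?n ^ (j div 2)"
        using C n1 that Suc \<open>j = Suc m\<close> by (intro mult_mono power_increasing) auto
      finally show ?thesis .
    qed
    have "real (Suc m) * \<bar>esym A f j\<bar> = \<bar>\<Sum>i\<le>m. (-1) ^ i * esym A f (m - i) * (\<Sum>a\<in>A. f a ^ Suc i)\<bar>"
      using newton_identity[OF assms(1), of m f] Suc by (metis abs_mult abs_of_nat)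
    also have "\<dots> \<le> (\<Sum>i\<le>m. C ^ j * ?n ^ (j div 2))"
      by (rule order_trans[OF sum_abs]) (intro sum_mono term_le, simp)
    also have "\<dots> = real (Suc m) * (C ^ j * ?n ^ (j div 2))" by simp
    finally show ?thesis by (simp only: mult_le_cancel_left_pos of_nat_0_less_iff zero_less_Suc)
  qed
qed

text \<open>The lower bound \<open>(n / j)^j\<close> for the binomial coefficient turns
  \<open>esym_bound\<close> into decay of all terms of degree at least 3. The range
  \<open>max 2 k\<close> provides the second moment even when \<open>k < 2\<close>. \<open>D\<close>
  depends on \<open>C\<close> and \<open>k\<close> only, so the estimate is uniform in
  \<open>A\<close> and \<open>f\<close>.\<close>

lemma esym_mean_expansion:
  assumes "1 \<le> C"
  obtains D where "0 \<le> D"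
    "\<And>(A :: 'i set) f. finite A \<Longrightarrow> k \<le> card A \<Longrightarrow> 2 \<le> card A \<Longrightarrow> (\<Sum>a\<in>A. f a) = 0 \<Longrightarrow>
      (\<And>i. 2 \<le> i \<Longrightarrow> i \<le> max 2 k \<Longrightarrow> \<bar>\<Sum>a\<in>A. f a ^ i\<bar> \<le> C * real (card A)) \<Longrightarrow>
      \<bar>esym A (\<lambda>i. 1 + f i) k / real (card A choose k) - 1 +
        real k * (real k - 1) / 2 * (\<Sum>a\<in>A. (f a)\<^sup>2) / (real (card A))\<^sup>2\<bar> \<le> D / (real (card A))\<^sup>2"
proof
  \<comment> \<open>\<open>D1\<close> pays for the degrees from 3 on. The other summand of
    \<open>D\<close> pays for replacing \<open>n * (n - 1)\<close> by \<open>n^2\<close> in the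
    quadratic term, at a cost of \<open>k^2 / 2\<close> times \<open>2 * C / n^2\<close>.\<close>
  define D1 where "D1 = (\<Sum>j=3..k. real (k choose j) * C ^ j * real j ^ j)"
  define D where "D = D1 + real k * real k * C"
  have D1: "0 \<le> D1" unfolding D1_def using assms by (intro sum_nonneg) auto
  then show "0 \<le> D" unfolding D_def using assms by simp
  fix A :: "'i set" and f :: "'i \<Rightarrow> real"
  assume fin: "finite A" and kn: "k \<le> card A" and n2: "2 \<le> card A" and s0: "(\<Sum>a\<in>A. f a) = 0"
    and p: "\<And>i. 2 \<le> i \<Longrightarrow> i \<le> max 2 k \<Longrightarrow> \<bar>\<Sum>a\<in>A. f a ^ i\<bar> \<le> C * real (card A)"
  define n where "n = card A"
  define V where "V = (\<Sum>a\<in>A. (f a)\<^sup>2)"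
  have V: "0 \<le> V" "V \<le> C * real n" using p[of 2] by (auto simp: V_def n_def sum_nonneg)
  have nch: "real (n choose j) > 0" if "j \<le> n" for j using that by simp
  have e1: "esym A f 1 = 0" using newton_identity[OF fin, of 0 f] fin s0 by simp
  have e2: "esym A f 2 = - V / 2"
    using newton_identity[OF fin, of 1 f] e1 fin by (simp add: V_def numeral_2_eq_2)
  \<comment> \<open>By \<open>choose_mult\<close>,
    \<open>(n - j choose k - j) / (n choose k)\<close> equals
    \<open>(k choose j) / (n choose j)\<close>, which separates the dependence on \<open>k\<close>
    from that on \<open>n\<close>.\<close>
  define t where "t j = real (k choose j) * esym A f j / real (n choose j)" for j
  have "esym A (\<lambda>i. 1 + f i) k / real (n choose k) =
      (\<Sum>j\<le>k. real ((n - j) choose (k - j)) * esym A f j / real (n choose k))"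
    unfolding esym_one_plus[OF fin] n_def by (simp add: sum_divide_distrib)
  also have "\<dots> = (\<Sum>j\<le>k. t j)"
  proof (rule sum.cong[OF refl])
    fix j assume "j \<in> {..k}"
    then have "(n choose k) * (k choose j) = (n choose j) * ((n - j) choose (k - j))" "j \<le> n"
      using kn by (auto intro!: choose_mult simp: n_def)
    then have "real (n choose k) * real (k choose j) = real (n choose j) * real ((n - j) choose (k - j))"
      by (metis of_nat_mult)
    then show "real ((n - j) choose (k - j)) * esym A f j / real (n choose k) = t j"
      using nch[of k] nch[of j] kn \<open>j \<le> n\<close> unfolding t_def n_def
      by (simp add: field_simps)
  qed
  also have "\<dots> = t 0 + t 1 + t 2 + (\<Sum>j=3..k. t j)"
  proof -
    \<comment> \<open>Padding with the vanishing coefficients \<open>k choose j\<close> for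
      \<open>j > k\<close> lets the degrees 0, 1, 2 be split off for every \<open>k\<close>.\<close>
    have "(\<Sum>j\<le>k. t j) = (\<Sum>j\<le>max 2 k. t j)"
      by (rule sum.mono_neutral_left) (auto simp: t_def)
    also have "{..max 2 k} = {0,1,2} \<union> {3..k}" by auto
    also have "(\<Sum>j\<in>{0,1,2} \<union> {3..k}. t j) = (\<Sum>j\<in>{0,1,2}. t j) + (\<Sum>j=3..k. t j)"
      by (rule sum.union_disjoint) auto
    finally show ?thesis by simp
  qed
  also have "t 0 = 1" using fin by (simp add: t_def)
  also have "t 1 = 0" using e1 by (simp add: t_def)
  also have "t 2 = - (real k * (real k - 1) / 2) * V / (real n * (real n - 1))"
  proof -
    have ch2: "real (m choose 2) = real m * (real m - 1) / 2" for m
      by (induction m) (auto simp: numeral_2_eq_2 field_simps)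
    show ?thesis unfolding t_def e2 ch2 using n2 by (simp add: n_def field_simps)
  qed
  finally have eq: "esym A (\<lambda>i. 1 + f i) k / real (n choose k) - 1 + real k * (real k - 1) / 2 * V / (real n)\<^sup>2
     = (\<Sum>j=3..k. t j) - (real k * (real k - 1) / 2) * (V / (real n * (real n - 1)) - V / (real n)\<^sup>2)"
    by (simp add: algebra_simps)
  have n0: "real n \<ge> 2" using n2 by (simp add: n_def)
  have "\<bar>\<Sum>j=3..k. t j\<bar> \<le> (\<Sum>j=3..k. real (k choose j) * C ^ j * real j ^ j / (real n)\<^sup>2)"
  proof (rule order_trans[OF sum_abs], rule sum_mono)
    fix j assume j: "j \<in> {3..k}"
    then have jn: "j \<le> n" using kn by (simp add: n_def)
    have b: "(real n / real j) ^ j \<le> real (n choose j)" by (rule binomial_ge_n_over_k_pow_k[OF jn])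
    have eb: "\<bar>esym A f j\<bar> \<le> C ^ j * real n ^ (j div 2)"
      unfolding n_def using esym_bound[OF fin assms s0, of k j] p n2 j by auto
    \<comment> \<open>Here \<open>j \<ge> 3\<close> is essential; the inequality is an equality for
      \<open>j = 3\<close> and \<open>j = 4\<close>.\<close>
    have j2: "j div 2 + 2 \<le> j" using j by auto
    have "\<bar>esym A f j\<bar> / real (n choose j) \<le> C ^ j * real n ^ (j div 2) / (real n / real j) ^ j"
      by (rule frac_le) (use eb b assms n0 j in auto)
    also have "\<dots> = C ^ j * real j ^ j * (real n ^ (j div 2) / real n ^ j)"
      by (simp add: power_divide)
    also have "\<dots> \<le> C ^ j * real j ^ j * (1 / (real n)\<^sup>2)"
    proof (rule mult_left_mono)
      have "real n ^ (j div 2) * (real n)\<^sup>2 \<le> real n ^ j"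
        unfolding power_add[symmetric] using j2 n0 by (intro power_increasing) auto
      then show "real n ^ (j div 2) / real n ^ j \<le> 1 / (real n)\<^sup>2" using n0 by (simp add: field_simps)
    qed (use assms in simp)
    finally have *: "\<bar>esym A f j\<bar> / real (n choose j) \<le> C ^ j * real j ^ j * (1 / (real n)\<^sup>2)" .
    have "\<bar>t j\<bar> = real (k choose j) * (\<bar>esym A f j\<bar> / real (n choose j))"
      by (simp add: t_def abs_mult)
    also have "\<dots> \<le> real (k choose j) * (C ^ j * real j ^ j * (1 / (real n)\<^sup>2))"
      by (rule mult_left_mono[OF *]) simp
    finally show "\<bar>t j\<bar> \<le> real (k choose j) * C ^ j * real j ^ j / (real n)\<^sup>2" by (simp add: mult.assoc)
  qed
  also have "\<dots> = D1 / (real n)\<^sup>2" by (simp add: D1_def sum_divide_distrib)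
  finally have b1: "\<bar>\<Sum>j=3..k. t j\<bar> \<le> D1 / (real n)\<^sup>2" .
  have eqV: "V / (real n * (real n - 1)) - V / (real n)\<^sup>2 = V / ((real n)\<^sup>2 * (real n - 1))"
    using n0 by (simp add: field_simps power2_eq_square)
  have "V / (real n - 1) \<le> 2 * C"
  proof -
    have "V \<le> C * real n" by (rule V)
    also have "\<dots> \<le> C * (2 * (real n - 1))" using n0 assms by (intro mult_left_mono) auto
    finally show ?thesis using n0 by (simp add: field_simps)
  qed
  then have Vb: "0 \<le> V / ((real n)\<^sup>2 * (real n - 1))" "V / ((real n)\<^sup>2 * (real n - 1)) \<le> 2 * C / (real n)\<^sup>2"
    using V n0 divide_right_mono[of "V / (real n - 1)" "2 * C" "(real n)\<^sup>2"]
    by (auto simp: mult.commute)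
  have kk: "0 \<le> real k * (real k - 1) / 2" "real k * (real k - 1) / 2 \<le> real k * real k / 2"
    by (cases k; auto simp: field_simps)+
  have "\<bar>real k * (real k - 1) / 2 * (V / ((real n)\<^sup>2 * (real n - 1)))\<bar>
      \<le> real k * real k / 2 * (2 * C / (real n)\<^sup>2)"
    unfolding abs_of_nonneg[OF mult_nonneg_nonneg[OF kk(1) Vb(1)]]
    by (intro mult_mono kk Vb) (use kk in auto)
  then have "\<bar>esym A (\<lambda>i. 1 + f i) k / real (n choose k) - 1 + real k * (real k - 1) / 2 * V / (real n)\<^sup>2\<bar>
     \<le> D1 / (real n)\<^sup>2 + real k * real k / 2 * (2 * C / (real n)\<^sup>2)"
    unfolding eq eqV using b1 by linarith
  also have "\<dots> = D / (real n)\<^sup>2" by (simp add: D_def add_divide_distrib)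
  finally show "\<bar>esym A (\<lambda>i. 1 + f i) k / real (card A choose k) - 1 +
        real k * (real k - 1) / 2 * (\<Sum>a\<in>A. (f a)\<^sup>2) / (real (card A))\<^sup>2\<bar> \<le> D / (real (card A))\<^sup>2"
    by (simp add: n_def V_def)
qed

lemma esym_cmult: "esym A (\<lambda>i. c * f i) k = c ^ k * esym A f k"
  unfolding esym_def sum_distrib_left by (rule sum.cong) (auto simp: prod.distrib)

text \<open>The deviation \<open>u\<close> of the symmetric mean from 1 is \<open>O(1 / n)\<close>,
  so the quadratic error of \<open>ln (1 + u)\<close> is \<open>O(1 / n^2)\<close>. Division by
  \<open>k\<close> turns \<open>k * (k - 1) / 2\<close> into \<open>(k - 1) / 2\<close>, which is
  linear in \<open>k\<close>. The threshold in \<open>n\<close> is chosen before \<open>z\<close>,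
  because \<open>z\<close> will be random and will vary with \<open>n\<close>.\<close>

lemma ln_esym_mean_expansion:
  assumes "1 \<le> C" "1 \<le> k"
  obtains G where "0 \<le> G"
    "\<forall>\<^sub>F n in sequentially. \<forall>z. moments_bdd C (max 2 k) n z \<longrightarrow>
      esym {..<n} (\<lambda>i. 1 + z i) k / real (n choose k) > 0 \<and>
      \<bar>ln (esym {..<n} (\<lambda>i. 1 + z i) k / real (n choose k)) / real k +
        (real k - 1) / 2 * ((\<Sum>i<n. (z i)\<^sup>2) / (real n)\<^sup>2)\<bar> \<le> G / (real n)\<^sup>2"
proof -
  obtain D where D: "0 \<le> D" and exp_n: "\<And>(A :: nat set) f. finite A \<Longrightarrow> k \<le> card A \<Longrightarrow> 2 \<le> card A \<Longrightarrow> (\<Sum>a\<in>A. f a) = 0 \<Longrightarrow>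
      (\<And>i. 2 \<le> i \<Longrightarrow> i \<le> max 2 k \<Longrightarrow> \<bar>\<Sum>a\<in>A. f a ^ i\<bar> \<le> C * real (card A)) \<Longrightarrow>
      \<bar>esym A (\<lambda>i. 1 + f i) k / real (card A choose k) - 1 +
        real k * (real k - 1) / 2 * (\<Sum>a\<in>A. (f a)\<^sup>2) / (real (card A))\<^sup>2\<bar> \<le> D / (real (card A))\<^sup>2"
    using esym_mean_expansion[OF assms(1), of k, where 'i = nat] by blast
  define a where "a = real k * (real k - 1) / 2"
  have a0: "0 \<le> a" using assms(2) by (simp add: a_def)
  \<comment> \<open>\<open>B\<close> is a bound for \<open>n * \<bar>u\<bar>\<close>;
    \<open>N\<close> below makes \<open>B / n\<close> at most 1/2, which gives both positivity and
    the logarithm estimate.\<close>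
  define B where "B = a * C + D"
  have B0: "0 \<le> B" using a0 D assms by (simp add: B_def)
  define G where "G = D + 2 * B\<^sup>2"
  define N where "N = max (max 2 k) (nat \<lceil>2 * B\<rceil>)"
  have "esym {..<n} (\<lambda>i. 1 + z i) k / real (n choose k) > 0 \<and>
      \<bar>ln (esym {..<n} (\<lambda>i. 1 + z i) k / real (n choose k)) / real k +
        (real k - 1) / 2 * ((\<Sum>i<n. (z i)\<^sup>2) / (real n)\<^sup>2)\<bar> \<le> G / (real n)\<^sup>2"
    if n: "n \<ge> N" and z: "moments_bdd C (max 2 k) n z" for n z
  proof -
    \<comment> \<open>This \<open>V\<close> carries the divisor \<open>n^2\<close> and is therefore
      of order \<open>1 / n\<close>.\<close>
    define V where "V = (\<Sum>i<n. (z i)\<^sup>2) / (real n)\<^sup>2"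
    define u where "u = esym {..<n} (\<lambda>i. 1 + z i) k / real (n choose k) - 1"
    have nk: "n \<ge> k" "n \<ge> 2" "real n \<ge> 2 * B" using n by (auto simp: N_def nat_le_iff le_nat_iff ceiling_le_iff)
    have n1: "real n \<ge> 1" using nk by simp
    have V: "0 \<le> V" "V \<le> C / real n"
    proof -
      have "(\<Sum>i<n. (z i)\<^sup>2) \<le> C * real n"
        using z unfolding moments_bdd_def by (force dest!: bspec[where x = 2])
      then show "V \<le> C / real n" using n1 by (simp add: V_def field_simps power2_eq_square)
    qed (simp add: V_def sum_nonneg)
    have uV: "\<bar>u + a * V\<bar> \<le> D / (real n)\<^sup>2"
      using exp_n[of "{..<n}" z] z nk unfolding moments_bdd_def u_def a_def V_def by auto
    have "\<bar>u\<bar> \<le> \<bar>u + a * V\<bar> + a * V" using a0 V mult_nonneg_nonneg[OF a0 V(1)] by linarith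
    also have "\<dots> \<le> D / (real n)\<^sup>2 + a * (C / real n)"
      by (intro add_mono uV mult_left_mono V a0)
    also have "D / (real n)\<^sup>2 \<le> D / real n"
      using D n1 by (intro divide_left_mono) (auto simp: power2_eq_square)
    finally have uB: "\<bar>u\<bar> \<le> B / real n" by (simp add: B_def add_divide_distrib)
    also have "\<dots> \<le> 1 / 2" using nk n1 by (simp add: field_simps)
    finally have u2: "\<bar>u\<bar> \<le> 1 / 2" .
    have "\<bar>ln (1 + u) - u\<bar> \<le> 2 * u\<^sup>2" by (rule abs_ln_one_plus_x_minus_x_bound[OF u2])
    also have "u\<^sup>2 \<le> (B / real n)\<^sup>2" using uB by (metis abs_ge_zero power2_abs power_mono)
    finally have "\<bar>ln (1 + u) - u\<bar> \<le> 2 * B\<^sup>2 / (real n)\<^sup>2" by (simp add: power_divide)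
    then have *: "\<bar>ln (1 + u) + a * V\<bar> \<le> G / (real n)\<^sup>2"
      using uV by (simp add: G_def add_divide_distrib)
    have "ln (1 + u) / real k + (real k - 1) / 2 * V = (ln (1 + u) + a * V) / real k"
      using assms(2) by (simp add: a_def field_simps)
    then have "\<bar>ln (1 + u) / real k + (real k - 1) / 2 * V\<bar> = \<bar>ln (1 + u) + a * V\<bar> / real k"
      by simp
    also have "\<dots> \<le> \<bar>ln (1 + u) + a * V\<bar>"
      using divide_left_mono[of 1 "real k" "\<bar>ln (1 + u) + a * V\<bar>"] assms(2) by simp
    finally have "\<bar>ln (1 + u) / real k + (real k - 1) / 2 * V\<bar> \<le> G / (real n)\<^sup>2" using * by linarith
    moreover have "1 + u > 0" using u2 by linarith
    ultimately show ?thesis by (simp add: u_def V_def)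
  qed
  moreover have "0 \<le> G" using D by (simp add: G_def)
  ultimately show thesis using that[of G] unfolding eventually_sequentially by blast
qed

section \<open>From symmetric means to the Maclaurin ratio\<close>

lemma exp_minus_one_minus_bound:
  fixes x :: real
  assumes "\<bar>x\<bar> \<le> 1"
  shows "\<bar>exp x - 1 - x\<bar> \<le> x\<^sup>2"
proof -
  have "exp x \<le> 1 + x + x\<^sup>2"
  proof (cases "0 \<le> x")
    case True
    then show ?thesis using assms by (intro exp_bound) auto
  next
    case False
    define y where "y = - x"
    have y: "0 \<le> y" using False by (simp add: y_def)
    have e: "1 + y + y\<^sup>2 / 2 \<le> exp y" by (rule exp_lower_Taylor_quadratic[OF y])
    \<comment> \<open>For \<open>x = - y\<close> the upper bound follows from the lower Taylor bound
      of \<open>exp y\<close>, once \<open>(1 - y + y^2) * (1 + y + y^2 / 2) \<ge> 1\<close> is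
      known; the product is expanded below.\<close>
    have q: "1 - y + y\<^sup>2 \<ge> 0" using zero_le_power2[of "y - 1/2"] by (simp add: power2_eq_square algebra_simps)
    have "1 \<le> 1 + y\<^sup>2 / 2 + y ^ 3 / 2 + y ^ 4 / 2" using y by simp
    also have "\<dots> = (1 - y + y\<^sup>2) * (1 + y + y\<^sup>2 / 2)"
      by (simp add: field_simps power2_eq_square power3_eq_cube power4_eq_xxxx)
    also have "\<dots> \<le> (1 - y + y\<^sup>2) * exp y" by (rule mult_left_mono[OF e q])
    finally have "exp (- y) \<le> 1 - y + y\<^sup>2" by (simp add: exp_minus field_simps)
    then show ?thesis by (simp add: y_def)
  qed
  then show ?thesis using exp_ge_add_one_self[of x] zero_le_power2[of x] by linarith
qed

text \<open>Homogeneity extracts the scale as \<open>c powr (1 / p)\<close>, a factor independent of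
  \<open>k\<close> that cancels in the ratio.\<close>

lemma maclaurin_mean_eq:
  assumes "0 < c" "1 \<le> k" "0 < p" and x: "\<And>i. i < n \<Longrightarrow> \<bar>x i\<bar> powr p = c * (1 + z i)"
    and pos: "esym {..<n} (\<lambda>i. 1 + z i) k / real (n choose k) > 0" (is "?E > 0")
  shows "maclaurin_mean k p n x = c powr (1 / p) * exp (ln ?E / real k / p)"
proof -
  have "(\<Sum>I | I \<subseteq> {..<n} \<and> card I = k. \<Prod>i\<in>I. \<bar>x i\<bar> powr p) = esym {..<n} (\<lambda>i. c * (1 + z i)) k"
    unfolding esym_def by (intro sum.cong refl prod.cong) (use x in auto)
  also have "\<dots> = c ^ k * esym {..<n} (\<lambda>i. 1 + z i) k" by (rule esym_cmult)
  finally have "maclaurin_mean k p n x = (c ^ k * ?E) powr (1 / (real k * p))"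
    unfolding maclaurin_mean_def by simp
  also have "\<dots> = (c powr real k) powr (1 / (real k * p)) * ?E powr (1 / (real k * p))"
    using assms(1) pos by (simp only: powr_realpow powr_mult less_imp_le zero_le_power)
  also have "(c powr real k) powr (1 / (real k * p)) = c powr (1 / p)"
    using assms by (simp add: powr_powr)
  also have "?E powr (1 / (real k * p)) = exp (ln ?E / real k / p)"
    using less_imp_neq[OF pos] by (simp only: powr_def) (simp add: field_simps)
  finally show ?thesis .
qed

text \<open>The logarithm \<open>L\<close> of the ratio is a difference of two logarithmic
  expansions, whose quadratic coefficients differ by \<open>d / 2\<close>. As \<open>L\<close> is
  \<open>O(1 / n)\<close>, exponentiating costs only \<open>O(1 / n^2)\<close>. The factor
  \<open>n * p / d\<close> makes the coefficient of the variance 1/2 for all \<open>k1\<close>,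
  \<open>k2\<close>.\<close>

lemma maclaurin_ratio_expansion:
  assumes "1 \<le> C" "1 \<le> k1" "k1 < k2" "1 \<le> p"
  obtains D where "0 \<le> D"
    "\<forall>\<^sub>F n in sequentially. \<forall>z c x. moments_bdd C k2 n z \<longrightarrow> 0 < c \<longrightarrow>
      (\<forall>i<n. \<bar>x i\<bar> powr p = c * (1 + z i)) \<longrightarrow>
      \<bar>real n * p / (real k2 - real k1) * (maclaurin_ratio k1 k2 p n x - 1) +
        (\<Sum>i<n. (z i)\<^sup>2) / real n / 2\<bar> \<le> D / real n"
proof -
  have k: "1 \<le> k2" "max 2 k2 = k2" "max 2 k1 \<le> k2" using assms by auto
  define E where "E k n z = esym {..<n} (\<lambda>i. 1 + z i) k / real (n choose k)" for k n z
  obtain G1 where G1: "0 \<le> G1" and ev1: "\<forall>\<^sub>F n in sequentially. \<forall>z. moments_bdd C (max 2 k1) n z \<longrightarrow>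
      E k1 n z > 0 \<and> \<bar>ln (E k1 n z) / real k1 +
        (real k1 - 1) / 2 * ((\<Sum>i<n. (z i)\<^sup>2) / (real n)\<^sup>2)\<bar> \<le> G1 / (real n)\<^sup>2"
    using ln_esym_mean_expansion[OF assms(1,2)] unfolding E_def by blast
  obtain G2 where G2: "0 \<le> G2" and ev2: "\<forall>\<^sub>F n in sequentially. \<forall>z. moments_bdd C (max 2 k2) n z \<longrightarrow>
      E k2 n z > 0 \<and> \<bar>ln (E k2 n z) / real k2 +
        (real k2 - 1) / 2 * ((\<Sum>i<n. (z i)\<^sup>2) / (real n)\<^sup>2)\<bar> \<le> G2 / (real n)\<^sup>2"
    using ln_esym_mean_expansion[OF assms(1) k(1)] unfolding E_def by blast
  define d where "d = real k2 - real k1"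
  have d: "1 \<le> d" using assms by (simp add: d_def)
  \<comment> \<open>\<open>H / n\<close> bounds \<open>\<bar>L\<bar>\<close>: the part
    \<open>d * C\<close> comes from the quadratic term, the rest from the two remainders. Hence
    \<open>H^2\<close> in \<open>D\<close> is the cost of \<open>exp L - 1 - L\<close>.\<close>
  define H where "H = G1 + G2 + d * C"
  have H: "0 \<le> H" using G1 G2 d assms by (simp add: H_def)
  define D where "D = p / d * (G1 + G2 + H\<^sup>2)"
  have D: "0 \<le> D" using G1 G2 d assms by (simp add: D_def)
  have ev3: "\<forall>\<^sub>F n in sequentially. real n \<ge> max 1 H"
    by (rule eventually_compose_filterlim[OF eventually_ge_at_top filterlim_real_sequentially])
  have "\<forall>\<^sub>F n in sequentially. \<forall>z c x. moments_bdd C k2 n z \<longrightarrow> 0 < c \<longrightarrow>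
      (\<forall>i<n. \<bar>x i\<bar> powr p = c * (1 + z i)) \<longrightarrow>
      \<bar>real n * p / (real k2 - real k1) * (maclaurin_ratio k1 k2 p n x - 1) +
        (\<Sum>i<n. (z i)\<^sup>2) / real n / 2\<bar> \<le> D / real n"
    using ev1 ev2 ev3
  proof eventually_elim
    case (elim n)
    show ?case
    proof (intro allI impI)
      fix z c x assume z: "moments_bdd C k2 n z" and c: "0 < c"
        and x: "\<forall>i<n. \<bar>x i\<bar> powr p = c * (1 + z i)"
      have z1: "moments_bdd C (max 2 k1) n z" using z k(3) by (auto simp: moments_bdd_def)
      have n: "real n \<ge> 1" "real n \<ge> H" using elim(3) by auto
      define V where "V = (\<Sum>i<n. (z i)\<^sup>2) / (real n)\<^sup>2"
      have V: "0 \<le> V" "V \<le> C / real n"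
      proof -
        have "2 \<in> {2..k2}" using k by simp
        then have "(\<Sum>i<n. (z i)\<^sup>2) \<le> C * real n"
          using z unfolding moments_bdd_def by force
        then show "V \<le> C / real n" using n by (simp add: V_def field_simps power2_eq_square)
      qed (simp add: V_def sum_nonneg)
      define l1 where "l1 = ln (E k1 n z) / real k1"
      define l2 where "l2 = ln (E k2 n z) / real k2"
      have b1: "E k1 n z > 0" "\<bar>l1 + (real k1 - 1) / 2 * V\<bar> \<le> G1 / (real n)\<^sup>2"
        using elim(1) z1 by (auto simp: l1_def V_def)
      have b2: "E k2 n z > 0" "\<bar>l2 + (real k2 - 1) / 2 * V\<bar> \<le> G2 / (real n)\<^sup>2"
        using elim(2) z k by (auto simp: l2_def V_def)
      define L where "L = (l2 - l1) / p"
      have R: "maclaurin_ratio k1 k2 p n x = exp L"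
      proof -
        have "maclaurin_mean k1 p n x = c powr (1 / p) * exp (l1 / p)"
          using maclaurin_mean_eq[of c k1 p n x z] c assms x b1(1) unfolding E_def l1_def by simp
        moreover have "maclaurin_mean k2 p n x = c powr (1 / p) * exp (l2 / p)"
          using maclaurin_mean_eq[of c k2 p n x z] c assms x b2(1) k unfolding E_def l2_def by simp
        ultimately show ?thesis
          using c by (simp add: maclaurin_ratio_def L_def exp_diff diff_divide_distrib)
      qed
      have "\<bar>l2 - l1 + d / 2 * V\<bar> \<le> G2 / (real n)\<^sup>2 + G1 / (real n)\<^sup>2"
      proof -
        have "l2 - l1 + d / 2 * V = (l2 + (real k2 - 1) / 2 * V) - (l1 + (real k1 - 1) / 2 * V)"
          by (simp add: d_def field_simps)
        then show ?thesis using b1(2) b2(2) by linarith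
      qed
      then have 1: "\<bar>l2 - l1 + d / 2 * V\<bar> \<le> (G1 + G2) / (real n)\<^sup>2" by (simp add: add_divide_distrib)
      have "\<bar>L + d / (2 * p) * V\<bar> = \<bar>l2 - l1 + d / 2 * V\<bar> / p"
      proof -
        have "L + d / (2 * p) * V = (l2 - l1 + d / 2 * V) / p"
          using assms by (simp add: L_def field_simps)
        then show ?thesis using assms by simp
      qed
      also have "\<dots> \<le> \<bar>l2 - l1 + d / 2 * V\<bar> / 1"
        using assms by (intro divide_left_mono) auto
      finally have 2: "\<bar>L + d / (2 * p) * V\<bar> \<le> (G1 + G2) / (real n)\<^sup>2" using 1 by simp
      have "(G1 + G2) / (real n)\<^sup>2 \<le> (G1 + G2) / real n"
        using G1 G2 n by (intro divide_left_mono) (auto simp: power2_eq_square)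
      moreover have "0 \<le> d / (2 * p) * V" "d / (2 * p) * V \<le> d * (C / real n)"
      proof -
        have dp: "0 \<le> d / (2 * p)" "d / (2 * p) \<le> d"
          using d assms by (auto simp: field_simps)
        show "0 \<le> d / (2 * p) * V" by (intro mult_nonneg_nonneg dp V)
        show "d / (2 * p) * V \<le> d * (C / real n)" using dp V by (intro mult_mono) auto
      qed
      ultimately have "\<bar>L\<bar> \<le> (G1 + G2) / real n + d * (C / real n)" using 2 by linarith
      also have "\<dots> = H / real n" by (simp add: H_def add_divide_distrib)
      finally have LH: "\<bar>L\<bar> \<le> H / real n" .
      also have "\<dots> \<le> 1" using n by simp
      finally have "\<bar>exp L - 1 - L\<bar> \<le> L\<^sup>2" by (rule exp_minus_one_minus_bound)
      also have "L\<^sup>2 \<le> (H / real n)\<^sup>2" using LH by (metis abs_ge_zero power2_abs power_mono)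
      finally have "\<bar>exp L - 1 - L\<bar> \<le> H\<^sup>2 / (real n)\<^sup>2" by (simp add: power_divide)
      then have 3: "\<bar>exp L - 1 + d / (2 * p) * V\<bar> \<le> (G1 + G2 + H\<^sup>2) / (real n)\<^sup>2"
        using 2 by (simp add: add_divide_distrib)
      have "real n * p / d * (exp L - 1) + real n * V / 2 = real n * p / d * (exp L - 1 + d / (2 * p) * V)"
        using d assms by (simp add: field_simps)
      also have "\<bar>\<dots>\<bar> = real n * p / d * \<bar>exp L - 1 + d / (2 * p) * V\<bar>"
        using d assms by (simp add: abs_mult)
      also have "\<dots> \<le> real n * p / d * ((G1 + G2 + H\<^sup>2) / (real n)\<^sup>2)"
        using d assms by (intro mult_left_mono 3) auto
      also have "\<dots> = D / real n" using n by (simp add: D_def power2_eq_square)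
      finally show "\<bar>real n * p / (real k2 - real k1) * (maclaurin_ratio k1 k2 p n x - 1) +
        (\<Sum>i<n. (z i)\<^sup>2) / real n / 2\<bar> \<le> D / real n"
        using n unfolding R d_def[symmetric] V_def by (simp add: power2_eq_square)
    qed
  qed
  with D show thesis by (rule that)
qed

subsection \<open>The cone measure via p-Gaussians\<close>

lemma p_gaussian_density_nonneg: "1 \<le> p \<Longrightarrow> 0 \<le> p_gaussian_density p x"
  unfolding p_gaussian_density_def
  by (intro mult_nonneg_nonneg divide_nonneg_nonneg) (auto intro!: Gamma_real_nonneg add_pos_nonneg)

lemma p_gaussian_density_measurable [measurable]: "p_gaussian_density p \<in> borel_measurable borel"
  unfolding p_gaussian_density_def[abs_def] by measurable

lemma sets_p_gaussian [simp, measurable_cong]: "sets (p_gaussian p) = sets borel"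
  by (simp add: p_gaussian_def)

lemma space_p_gaussian [simp]: "space (p_gaussian p) = UNIV"
  by (simp add: p_gaussian_def)

text \<open>Substitution \<open>t = x^p / p\<close> in the Gamma integral at
  \<open>s = j + 1 / p\<close>. The origin is removed, as the substitution is carried out on the
  open half-line.\<close>

lemma p_gaussian_half_line_moment:
  assumes p: "1 \<le> p"
  shows "((\<lambda>x. (x powr p) ^ j * exp (- (x powr p) / p)) has_integral
    (p powr (real j + 1 / p - 1) * Gamma (real j + 1 / p))) {0<..}"
proof -
  define s where "s = real j + 1 / p"
  have s: "s > 0" using p by (simp add: s_def add_nonneg_pos)
  \<comment> \<open>The factor \<open>p powr (s - 1)\<close> cancels the power of \<open>p\<close>
    that appears when \<open>x powr p / p\<close> is inserted for \<open>t\<close>.\<close>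
  define f where "f t = p powr (s - 1) * (t powr (s - 1) / exp t)" for t :: real
  define I where "I = p powr (s - 1) * Gamma s"
  have "(f has_integral I) {0..}"
    unfolding f_def[abs_def] I_def by (intro has_integral_mult_right Gamma_integral_real s)
  moreover have "{t \<in> {0..} - {0<..}. f t \<noteq> 0} \<subseteq> {0}" "{t \<in> {0<..} - {0..}. f t \<noteq> 0} = {}"
    by auto
  ultimately have f_int: "(f has_integral I) {0<..}"
    by (subst has_integral_spike_set_eq[where T = "{0..}"]) (auto intro: negligible_subset)
  have img: "(\<lambda>x. x powr p / p) ` {0<..} = {0<..}"
  proof (intro equalityI subsetI)
    fix t :: real assume "t \<in> {0<..}"
    then have "t = ((p * t) powr (1 / p)) powr p / p" "(p * t) powr (1 / p) \<in> {0<..}"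
      using p by (auto simp: powr_powr)
    then show "t \<in> (\<lambda>x. x powr p / p) ` {0<..}" by blast
  qed (use p in auto)
  have inj: "inj_on (\<lambda>x. x powr p / p) {0<..}"
  proof (rule inj_onI)
    fix x y :: real assume xy: "x \<in> {0<..}" "y \<in> {0<..}" "x powr p / p = y powr p / p"
    then have "(x powr p) powr (1 / p) = (y powr p) powr (1 / p)" using p by simp
    then show "x = y" using xy p by (simp add: powr_powr)
  qed
  have der: "((\<lambda>x. x powr p / p) has_field_derivative x powr (p - 1)) (at x within {0<..})"
    if "x \<in> {0<..}" for x
    using that p by (auto intro!: derivative_eq_intros)
  have "f absolutely_integrable_on (\<lambda>x. x powr p / p) ` {0<..} \<and> integral ((\<lambda>x. x powr p / p) ` {0<..}) f = I"
    unfolding img using f_int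
    by (auto simp: f_def integral_unique intro!: nonnegative_absolutely_integrable_1 has_integral_integrable)
  then have "(\<lambda>x. \<bar>x powr (p - 1)\<bar> * f (x powr p / p)) absolutely_integrable_on {0<..} \<and>
      integral {0<..} (\<lambda>x. \<bar>x powr (p - 1)\<bar> * f (x powr p / p)) = I"
    using has_absolute_integral_change_of_variables_1'[OF _ der inj, of f I] by auto
  then have "((\<lambda>x. \<bar>x powr (p - 1)\<bar> * f (x powr p / p)) has_integral I) {0<..}"
    using absolutely_integrable_on_def has_integral_integral by (metis (no_types, lifting))
  moreover have "\<bar>x powr (p - 1)\<bar> * f (x powr p / p) = (x powr p) ^ j * exp (- (x powr p) / p)"
    if "x \<in> {0<..}" for x
  proof -
    have x: "x > 0" using that by simp
    have "f (x powr p / p) = (x powr p) powr (s - 1) * exp (- (x powr p) / p)"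
      using p x by (simp add: f_def powr_divide exp_minus field_simps)
    moreover have "\<bar>x powr (p - 1)\<bar> * (x powr p) powr (s - 1) = (x powr p) powr real j"
    proof -
      have "p * (s - 1) = p * real j + 1 - p" using p by (simp add: s_def field_simps)
      then show ?thesis using x by (simp add: powr_powr flip: powr_add)
    qed
    ultimately show ?thesis using x by (simp add: powr_realpow mult.assoc)
  qed
  ultimately show ?thesis
    unfolding I_def s_def by (rule has_integral_eq[rotated]) auto
qed

text \<open>Evenness doubles the half-line integral, and the normalising constant reduces the
  quotient of Gamma values to a rising factorial. The case \<open>j = 0\<close> shows that the
  density has mass 1.\<close>

lemma p_gaussian_moment:
  assumes p: "1 \<le> p"
  shows "has_bochner_integral (p_gaussian p) (\<lambda>x. (\<bar>x\<bar> powr p) ^ j) (p ^ j * pochhammer (1 / p) j)"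
proof -
  define h where "h x = (\<bar>x\<bar> powr p) ^ j * exp (- (\<bar>x\<bar> powr p) / p)" for x :: real
  define I where "I = p powr (real j + 1 / p - 1) * Gamma (real j + 1 / p)"
  have pj: "real j + 1 / p > 0" using p by (simp add: add_nonneg_pos)
  have I0: "I \<ge> 0" unfolding I_def using pj by (intro mult_nonneg_nonneg Gamma_real_nonneg) auto
  have [measurable]: "h \<in> borel_measurable borel" unfolding h_def[abs_def] by measurable
  have "(h has_integral I) {0<..}"
    unfolding I_def by (rule has_integral_eq[OF _ p_gaussian_half_line_moment[OF p]]) (simp add: h_def)
  then have "(h has_integral I) {0..}"
    by (subst has_integral_spike_set_eq[where T = "{0<..}"])
       (auto intro: negligible_subset[of "{0}"])
  then have "(\<integral>\<^sup>+x. ennreal (indicator {0..} x * h x) \<partial>lborel) = ennreal I"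
    by (rule nn_integral_has_integral_lebesgue[rotated]) (simp add: h_def)
  then have "has_bochner_integral lborel (\<lambda>x. indicator {0..} x *\<^sub>R h x) I"
    using I0 by (intro has_bochner_integral_nn_integral) (auto simp: h_def)
  then have "has_bochner_integral lborel h (2 *\<^sub>R I)"
    by (rule has_bochner_integral_even_function) (simp add: h_def)
  then have "has_bochner_integral lborel
      (\<lambda>x. 1 / (2 * p powr (1 / p) * Gamma (1 + 1 / p)) * h x)
      (1 / (2 * p powr (1 / p) * Gamma (1 + 1 / p)) * (2 *\<^sub>R I))"
    by (intro has_bochner_integral_mult_right) auto
  also have "1 / (2 * p powr (1 / p) * Gamma (1 + 1 / p)) * (2 *\<^sub>R I) = p ^ j * pochhammer (1 / p) j"
  proof -
    have "1 / p > 0" using p by simp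
    then have G: "Gamma (1 / p) \<noteq> 0" by (metis Gamma_real_pos less_irrefl)
    have np: "1 / p \<notin> \<int>\<^sub>\<le>\<^sub>0"
      using p nonpos_Ints_nonpos[of "1 / p"] by (auto simp: not_le)
    have 1: "Gamma (1 + 1 / p) = Gamma (1 / p) / p"
      using p np Gamma_plus1[of "1 / p"] by (simp add: add.commute)
    have 2: "Gamma (real j + 1 / p) = pochhammer (1 / p) j * Gamma (1 / p)"
      using np pochhammer_Gamma[of "1 / p" j] G by (simp add: add.commute)
    have 3: "p powr (real j + 1 / p - 1) = p ^ j * p powr (1 / p) / p"
      using p by (simp add: powr_add powr_diff powr_realpow)
    show ?thesis unfolding I_def 1 2 3 using G p by (simp add: field_simps)
  qed
  also have "(\<lambda>x. 1 / (2 * p powr (1 / p) * Gamma (1 + 1 / p)) * h x) =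
      (\<lambda>x. p_gaussian_density p x *\<^sub>R (\<bar>x\<bar> powr p) ^ j)"
    by (auto simp: h_def p_gaussian_density_def fun_eq_iff)
  finally show ?thesis
    unfolding p_gaussian_def using p
    by (intro has_bochner_integral_density) (auto simp: p_gaussian_density_nonneg)
qed

lemma prob_space_p_gaussian:
  assumes "1 \<le> p"
  shows "prob_space (p_gaussian p)"
proof
  have "has_bochner_integral (p_gaussian p) (\<lambda>x. 1 :: real) 1"
    using p_gaussian_moment[OF assms, of 0] by simp
  then have "(\<integral>\<^sup>+x. ennreal 1 \<partial>p_gaussian p) = ennreal 1"
    by (subst nn_integral_eq_integral) (auto simp: has_bochner_integral_iff)
  then show "emeasure (p_gaussian p) (space (p_gaussian p)) = 1" by simp
qed

section \<open>Dilations and the direction of a p-Gaussian vector\<close>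

text \<open>A product measure is determined by its values on boxes, and on a box every coordinate
  contributes one factor \<open>c\<close>.\<close>

lemma distr_lborel_n_divide:
  assumes "c > 0"
  shows "density (distr (lborel_n n) (lborel_n n) (\<lambda>x. \<lambda>i\<in>{..<n}. x i / c)) (\<lambda>_. ennreal (1 / c ^ n)) = lborel_n n"
    (is "?P = _")
proof -
  interpret product_sigma_finite "\<lambda>_::nat. lborel :: real measure" ..
  have meas: "(\<lambda>x. \<lambda>i\<in>{..<n}. x i / c) \<in> measurable (lborel_n n) (lborel_n n)"
    unfolding lborel_n_def by measurable
  show ?thesis
    unfolding lborel_n_def
  proof (rule PiM_eqI)
    fix A :: "nat \<Rightarrow> real set" assume A: "\<And>i. i \<in> {..<n} \<Longrightarrow> A i \<in> sets lborel"
    have box: "Pi\<^sub>E {..<n} A \<in> sets (lborel_n n)"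
      unfolding lborel_n_def using A by (intro sets_PiM_I_finite) auto
    have scale: "emeasure lborel ((\<lambda>x. x / c) -` B) = ennreal c * emeasure lborel B"
      if [measurable]: "B \<in> sets borel" for B :: "real set"
    proof -
      have "emeasure lborel ((\<lambda>x. x / c) -` B) = emeasure (distr lborel borel ((*) (1 / c))) B"
        by (subst emeasure_distr) (auto simp: vimage_def)
      also have "\<dots> = ennreal c * emeasure lborel B"
        using assms by (subst lborel_distr_mult) (auto simp: emeasure_density_const)
      finally show ?thesis .
    qed
    have "emeasure ?P (Pi\<^sub>E {..<n} A) = ennreal (1 / c ^ n) *
        emeasure (lborel_n n) ((\<lambda>x. \<lambda>i\<in>{..<n}. x i / c) -` Pi\<^sub>E {..<n} A \<inter> space (lborel_n n))"
      using box meas by (subst emeasure_density_const) (auto simp: emeasure_distr)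
    also have "(\<lambda>x. \<lambda>i\<in>{..<n}. x i / c) -` Pi\<^sub>E {..<n} A \<inter> space (lborel_n n) =
        Pi\<^sub>E {..<n} (\<lambda>i. (\<lambda>x. x / c) -` A i)"
      by (auto simp: space_lborel_n PiE_iff)
    also have "emeasure (lborel_n n) \<dots> = (\<Prod>i<n. emeasure lborel ((\<lambda>x. x / c) -` A i))"
      unfolding lborel_n_def
    proof (rule emeasure_PiM)
      fix i assume "i \<in> {..<n}"
      then have [measurable]: "A i \<in> sets borel" using A by simp
      show "(\<lambda>x. x / c) -` A i \<in> sets lborel"
        using measurable_sets[of "\<lambda>x. x / c" borel borel "A i"] by simp
    qed simp
    also have "\<dots> = (\<Prod>i<n. ennreal c * emeasure lborel (A i))"
      using A by (intro prod.cong refl scale) auto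
    also have "\<dots> = ennreal (c ^ n) * (\<Prod>i<n. emeasure lborel (A i))"
      using assms by (simp add: prod.distrib ennreal_power)
    also have "ennreal (1 / c ^ n) * \<dots> = (\<Prod>i<n. emeasure lborel (A i))"
    proof -
      have "ennreal (1 / c ^ n) * ennreal (c ^ n) = 1"
        using assms by (simp flip: ennreal_mult)
      then show ?thesis by (simp flip: mult.assoc)
    qed
    finally show "emeasure (density (distr (Pi\<^sub>M {..<n} (\<lambda>i. lborel)) (Pi\<^sub>M {..<n} (\<lambda>i. lborel))
       (\<lambda>x. \<lambda>i\<in>{..<n}. x i / c)) (\<lambda>_. ennreal (1 / c ^ n))) (Pi\<^sub>E {..<n} A) = (\<Prod>i<n. emeasure lborel (A i))"
      unfolding lborel_n_def .
  qed auto
qed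

lemma emeasure_lborel_n_scale:
  assumes "c > 0" and B: "B \<in> sets (lborel_n n)"
  shows "emeasure (lborel_n n) {x \<in> space (lborel_n n). (\<lambda>i\<in>{..<n}. x i / c) \<in> B} =
    ennreal (c ^ n) * emeasure (lborel_n n) B"
proof -
  have meas: "(\<lambda>x. \<lambda>i\<in>{..<n}. x i / c) \<in> measurable (lborel_n n) (lborel_n n)"
    unfolding lborel_n_def by measurable
  have "emeasure (lborel_n n) B = ennreal (1 / c ^ n) *
      emeasure (lborel_n n) ((\<lambda>x. \<lambda>i\<in>{..<n}. x i / c) -` B \<inter> space (lborel_n n))"
    by (subst distr_lborel_n_divide[OF assms(1), symmetric], subst emeasure_density_const)
       (use B meas in \<open>auto simp: emeasure_distr\<close>)
  moreover have "ennreal (c ^ n) * ennreal (1 / c ^ n) = 1"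
    using assms by (simp flip: ennreal_mult)
  moreover have "(\<lambda>x. \<lambda>i\<in>{..<n}. x i / c) -` B \<inter> space (lborel_n n) =
      {x \<in> space (lborel_n n). (\<lambda>i\<in>{..<n}. x i / c) \<in> B}" by auto
  ultimately show ?thesis by (simp flip: mult.assoc)
qed

text \<open>The joint density depends on the point only through the sum of \<open>|x i|^p\<close>,
  that is, through its norm. This radial form is what links the direction of the vector to the cone
  measure.\<close>

lemma PiM_p_gaussian_eq_density:
  assumes p: "1 \<le> p"
  shows "PiM {..<n} (\<lambda>_. p_gaussian p) =
    density (lborel_n n) (\<lambda>x. ennreal ((1 / (2 * p powr (1 / p) * Gamma (1 + 1 / p))) ^ n) *
      ennreal (exp (- (\<Sum>i<n. \<bar>x i\<bar> powr p) / p)))" (is "_ = density _ ?f")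
proof -
  interpret L: product_sigma_finite "\<lambda>_::nat. lborel :: real measure" ..
  interpret G: prob_space "p_gaussian p" by (rule prob_space_p_gaussian[OF p])
  interpret P: product_sigma_finite "\<lambda>_::nat. p_gaussian p" by unfold_locales
  have comp [measurable]: "(\<lambda>x. x i) \<in> borel_measurable (lborel_n n)" if "i \<in> {..<n}" for i
    using measurable_component_singleton[OF that, of "\<lambda>_. lborel"] by (simp add: lborel_n_def)
  have [measurable]: "?f \<in> borel_measurable (lborel_n n)" by measurable
  have f: "?f x = (\<Prod>i<n. ennreal (p_gaussian_density p (x i)))" for x
  proof -
    have "(\<Prod>i<n. ennreal (p_gaussian_density p (x i))) = ennreal (\<Prod>i<n. p_gaussian_density p (x i))"
      by (intro prod_ennreal p_gaussian_density_nonneg p)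
    also have "(\<Prod>i<n. p_gaussian_density p (x i)) =
        (1 / (2 * p powr (1 / p) * Gamma (1 + 1 / p))) ^ n * exp (- (\<Sum>i<n. \<bar>x i\<bar> powr p) / p)"
      unfolding p_gaussian_density_def prod.distrib
      by (simp add: exp_sum sum_negf sum_divide_distrib flip: sum_negf)
    finally show ?thesis by (simp add: ennreal_mult'')
  qed
  show ?thesis
  proof (rule P.PiM_eqI[symmetric])
    show "sets (density (lborel_n n) ?f) = sets (PiM {..<n} (\<lambda>_. p_gaussian p))"
      unfolding sets_density sets_lborel_n by (rule sets_PiM_cong) auto
    fix A :: "nat \<Rightarrow> real set" assume A: "\<And>i. i \<in> {..<n} \<Longrightarrow> A i \<in> sets (p_gaussian p)"
    then have [measurable]: "i \<in> {..<n} \<Longrightarrow> A i \<in> sets borel" for i by simp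
    have box: "Pi\<^sub>E {..<n} A \<in> sets (lborel_n n)"
      unfolding lborel_n_def using A by (intro sets_PiM_I_finite) auto
    have "emeasure (density (lborel_n n) ?f) (Pi\<^sub>E {..<n} A) =
        (\<integral>\<^sup>+x. ?f x * indicator (Pi\<^sub>E {..<n} A) x \<partial>lborel_n n)"
      using box by (intro emeasure_density) auto
    also have "\<dots> = (\<integral>\<^sup>+x. (\<Prod>i<n. ennreal (p_gaussian_density p (x i)) * indicator (A i) (x i)) \<partial>lborel_n n)"
    proof (rule nn_integral_cong)
      fix x assume x: "x \<in> space (lborel_n n)"
      have "(indicator (Pi\<^sub>E {..<n} A) x :: ennreal) = (\<Prod>i<n. indicator (A i) (x i))"
      proof (cases "x \<in> Pi\<^sub>E {..<n} A")
        case False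
        then obtain i where i: "i < n" "x i \<notin> A i" using x by (auto simp: space_lborel_n PiE_iff)
        then have "(\<Prod>i<n. indicator (A i) (x i)) = (0 :: ennreal)"
          using i by (intro prod_zero bexI[of _ i]) auto
        with False show ?thesis by simp
      qed (auto simp: PiE_iff)
      then show "?f x * indicator (Pi\<^sub>E {..<n} A) x =
          (\<Prod>i<n. ennreal (p_gaussian_density p (x i)) * indicator (A i) (x i))"
        unfolding f by (simp add: prod.distrib)
    qed
    also have "\<dots> = (\<Prod>i<n. \<integral>\<^sup>+x. ennreal (p_gaussian_density p x) * indicator (A i) x \<partial>lborel)"
      unfolding lborel_n_def by (intro L.product_nn_integral_prod) auto
    also have "\<dots> = (\<Prod>i<n. emeasure (p_gaussian p) (A i))"
      unfolding p_gaussian_def by (intro prod.cong refl emeasure_density[symmetric]) auto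
    finally show "emeasure (density (lborel_n n) ?f) (Pi\<^sub>E {..<n} A) = (\<Prod>i<n. emeasure (p_gaussian p) (A i))" .
  qed auto
qed

lemma sum_powr_eq_lp_norm_powr:
  assumes "1 \<le> p"
  shows "(\<Sum>i<n. \<bar>x i\<bar> powr p) = lp_norm p n x powr p"
  using assms by (simp add: lp_norm_def powr_powr sum_nonneg)

text \<open>
  The weight is written as the Lebesgue measure of \<open>{0<..exp (- \<parallel>x\<parallel>\<^sup>p / p)}\<close>; after exchanging
  the integrals, the set above height \<open>u\<close> is a dilate of the truncated cone.
\<close>

lemma nn_integral_exp_cone:
  assumes p: "1 \<le> p"
  obtains K where "\<And>A. A \<in> sets (lborel_n n) \<Longrightarrow>
    (\<integral>\<^sup>+x. ennreal (exp (- (\<Sum>i<n. \<bar>x i\<bar> powr p) / p)) * indicator A (lp_normalize p n x) \<partial>lborel_n n) =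
    K * emeasure (lborel_n n) (lp_ball p n \<inter> (lp_normalize p n -` A \<inter> space (lborel_n n)))"
proof
  let ?L = "lborel_n n"
  fix A assume A [measurable]: "A \<in> sets ?L"
  interpret L: product_sigma_finite "\<lambda>_::nat. lborel :: real measure" ..
  interpret S: sigma_finite_measure ?L
    unfolding lborel_n_def by (rule L.sigma_finite) simp
  interpret pair_sigma_finite ?L "lborel :: real measure" ..
  have radial_measurable: "(\<lambda>u :: real. indicator {0<..<1} u * ennreal (((- p * ln u) powr (1 / p)) ^ n)) \<in> borel_measurable lborel"
    by measurable
  have comp [measurable]: "(\<lambda>x. x i) \<in> borel_measurable ?L" if "i \<in> {..<n}" for i
    using measurable_component_singleton[OF that, of "\<lambda>_. lborel"] by (simp add: lborel_n_def)
  define N where "N x = (\<Sum>i<n. \<bar>x i\<bar> powr p)" for x :: "nat \<Rightarrow> real"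
  have [measurable]: "N \<in> borel_measurable ?L" unfolding N_def[abs_def] by measurable
  define B where "B = lp_ball p n \<inter> (lp_normalize p n -` A \<inter> space ?L)"
  have B [measurable]: "B \<in> sets ?L" unfolding B_def by measurable
  \<comment> \<open>The region under the weight is a fixed planar set evaluated at
    \<open>(u, exp (- N x / p))\<close>; this yields the joint measurability needed to exchange the
    integrals.\<close>
  define g :: "(nat \<Rightarrow> real) \<Rightarrow> real \<Rightarrow> ennreal" where "g x u = indicator A (lp_normalize p n x) * indicator {v. 0 < fst v \<and> fst v \<le> snd v} (u, exp (- N x / p))"
    for x u
  have "(\<integral>\<^sup>+x. ennreal (exp (- N x / p)) * indicator A (lp_normalize p n x) \<partial>?L) =
      (\<integral>\<^sup>+x. \<integral>\<^sup>+u. g x u \<partial>lborel \<partial>?L)"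
  proof (rule nn_integral_cong)
    fix x
    have "(\<integral>\<^sup>+u. g x u \<partial>lborel) = (\<integral>\<^sup>+u. indicator A (lp_normalize p n x) * indicator {0<..exp (- N x / p)} u \<partial>lborel)"
      by (intro nn_integral_cong) (auto simp: g_def split: split_indicator)
    also have "\<dots> = ennreal (exp (- N x / p)) * indicator A (lp_normalize p n x)"
      by (subst nn_integral_cmult_indicator) (auto simp: mult.commute)
    finally show "ennreal (exp (- N x / p)) * indicator A (lp_normalize p n x) = (\<integral>\<^sup>+u. g x u \<partial>lborel)" ..
  qed
  also have "\<dots> = (\<integral>\<^sup>+u. \<integral>\<^sup>+x. g x u \<partial>?L \<partial>lborel)"
  proof (rule Fubini'[symmetric])
    have "{v :: real \<times> real \<in> space (borel \<Otimes>\<^sub>M borel). 0 < fst v \<and> fst v \<le> snd v} \<in> sets (borel \<Otimes>\<^sub>M borel)"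
      by measurable
    then have [measurable]: "{v :: real \<times> real. 0 < fst v \<and> fst v \<le> snd v} \<in> sets (borel \<Otimes>\<^sub>M borel)"
      by (simp add: space_pair_measure)
    show "(\<lambda>(x, u). g x u) \<in> borel_measurable (?L \<Otimes>\<^sub>M lborel)"
      unfolding g_def[abs_def] by measurable
  qed
  also have "\<dots> = (\<integral>\<^sup>+u. (indicator {0<..<1} u * ennreal (((- p * ln u) powr (1 / p)) ^ n)) * emeasure ?L B \<partial>lborel)"
  proof (rule nn_integral_cong_AE)
    \<comment> \<open>At \<open>u = 1\<close> only points of norm 0 remain, and for
      \<open>n = 0\<close> they have positive measure. Dropping this single height makes the formula
      valid for every \<open>n\<close>.\<close>
    have "AE u in lborel. u \<noteq> (1::real)" by (rule AE_lborel_singleton)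
    then show "AE u in lborel. (\<integral>\<^sup>+x. g x u \<partial>?L) =
        indicator {0<..<1} u * ennreal (((- p * ln u) powr (1 / p)) ^ n) * emeasure ?L B"
    proof eventually_elim
      fix u :: real assume u1: "u \<noteq> 1"
      show "(\<integral>\<^sup>+x. g x u \<partial>?L) = indicator {0<..<1} u * ennreal (((- p * ln u) powr (1 / p)) ^ n) * emeasure ?L B"
      proof (cases "0 < u \<and> u < 1")
        case True
        \<comment> \<open>The radius at which the weight equals \<open>u\<close>: points of weight
          at least \<open>u\<close> form the ball of radius \<open>t\<close>.\<close>
        define t where "t = (- p * ln u) powr (1 / p)"
        have lnu: "- p * ln u > 0" using True p by (simp add: mult_pos_neg)
        have t: "t > 0" unfolding t_def using lnu by (subst powr_gt_zero) linarith
        have powr_powr_inverse: "(w powr (1 / p)) powr p = w" if "w > 0" for w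
          using that p by (simp add: powr_powr)
        have eq: "g x u = indicator {x \<in> space ?L. (\<lambda>i\<in>{..<n}. x i / t) \<in> B} x" if x: "x \<in> space ?L" for x
        proof -
          have 1: "lp_norm p n (\<lambda>i\<in>{..<n}. x i / t) = lp_norm p n x / t"
            using lp_norm_cmult[OF p, of n "1 / t" x] t by (simp add: field_simps)
          have 2: "lp_normalize p n (\<lambda>i\<in>{..<n}. x i / t) = lp_normalize p n x"
            using t unfolding lp_normalize_def 1 by (auto simp: fun_eq_iff)
          have "u \<le> exp (- N x / p) \<longleftrightarrow> ln u \<le> - N x / p"
            using True by (metis exp_le_cancel_iff exp_ln)
          also have "\<dots> \<longleftrightarrow> lp_norm p n x powr p \<le> - p * ln u"
            using p unfolding N_def sum_powr_eq_lp_norm_powr[OF p] by (auto simp: field_simps)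
          also have "- p * ln u = t powr p"
            unfolding t_def by (rule powr_powr_inverse[OF lnu, symmetric])
          also have "lp_norm p n x powr p \<le> t powr p \<longleftrightarrow> lp_norm p n x \<le> t"
            using p t lp_norm_nonneg[of p n x] by (meson less_le_not_le less_le_trans linorder_not_less
              order_less_imp_le powr_less_mono2 powr_mono2 zero_less_one)
          finally have "u \<le> exp (- N x / p) \<longleftrightarrow> lp_norm p n x / t \<le> 1"
            using t by (simp add: field_simps)
          then show ?thesis
            using True x unfolding g_def B_def lp_ball_def
            by (auto simp: 1 2 space_lborel_n split: split_indicator)
        qed
        have "{x \<in> space ?L. (\<lambda>i\<in>{..<n}. x i / t) \<in> B} \<in> sets ?L"
        proof -
          have "(\<lambda>x. \<lambda>i\<in>{..<n}. x i / t) \<in> measurable ?L ?L"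
            unfolding lborel_n_def by measurable
          from measurable_sets[OF this B] show ?thesis by (simp add: vimage_def Int_def conj_commute)
        qed
        then have "(\<integral>\<^sup>+x. g x u \<partial>?L) = emeasure ?L {x \<in> space ?L. (\<lambda>i\<in>{..<n}. x i / t) \<in> B}"
          by (subst nn_integral_cong[OF eq]) auto
        also have "\<dots> = ennreal (t ^ n) * emeasure ?L B"
          by (rule emeasure_lborel_n_scale[OF t B])
        finally show ?thesis using True by (simp add: t_def)
      next
        case False
        have "g x u = 0" for x
        proof -
          have "N x \<ge> 0" by (simp add: N_def sum_nonneg)
          then have "exp (- N x / p) \<le> 1" using p by simp
          then have "\<not> (0 < u \<and> u \<le> exp (- N x / p))" using False u1 by linarith
          then show ?thesis by (simp add: g_def)
        qed
        then show ?thesis using False by simp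
      qed
    qed
  qed
  also have "\<dots> = (\<integral>\<^sup>+u. indicator {0<..<1} u * ennreal (((- p * ln u) powr (1 / p)) ^ n) \<partial>lborel) * emeasure ?L B"
    by (rule nn_integral_multc[OF radial_measurable])
  \<comment> \<open>The radial integral on the right is the witness for \<open>K\<close>. It is free
    of \<open>A\<close>, and its value is never computed.\<close>
  finally show "(\<integral>\<^sup>+x. ennreal (exp (- (\<Sum>i<n. \<bar>x i\<bar> powr p) / p)) * indicator A (lp_normalize p n x) \<partial>?L) =
    (\<integral>\<^sup>+u. indicator {0<..<1} u * ennreal (((- p * ln u) powr (1 / p)) ^ n) \<partial>lborel) *
    emeasure ?L (lp_ball p n \<inter> (lp_normalize p n -` A \<inter> space ?L))"
    by (simp add: N_def B_def)
qed

text \<open>Both laws are constant multiples of the volume of the truncated cone over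
  \<open>A\<close>. Both have total mass 1, so the constants coincide; evaluating at the whole space
  determines \<open>c * K\<close>.\<close>

lemma cone_measure_eq_distr_p_gaussian:
  assumes p: "1 \<le> p" and n: "1 \<le> n"
  shows "cone_measure p n = distr (PiM {..<n} (\<lambda>_. p_gaussian p)) (lborel_n n) (lp_normalize p n)"
proof -
  let ?L = "lborel_n n" and ?G = "PiM {..<n} (\<lambda>_. p_gaussian p)"
  obtain K where K: "\<And>A. A \<in> sets ?L \<Longrightarrow>
    (\<integral>\<^sup>+x. ennreal (exp (- (\<Sum>i<n. \<bar>x i\<bar> powr p) / p)) * indicator A (lp_normalize p n x) \<partial>?L) =
    K * emeasure ?L (lp_ball p n \<inter> (lp_normalize p n -` A \<inter> space ?L))"
    using nn_integral_exp_cone[OF p] by blast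
  define c where "c = ennreal ((1 / (2 * p powr (1 / p) * Gamma (1 + 1 / p))) ^ n)"
  have sets_G: "sets ?G = sets ?L"
    unfolding sets_lborel_n by (rule sets_PiM_cong) auto
  have [measurable]: "lp_normalize p n \<in> measurable ?G ?L"
    using lp_normalize_measurable[of p n] by (simp add: measurable_cong_sets[OF sets_G refl])
  have comp [measurable]: "(\<lambda>x. x i) \<in> borel_measurable ?L" if "i \<in> {..<n}" for i
    using measurable_component_singleton[OF that, of "\<lambda>_. lborel"] by (simp add: lborel_n_def)
  have em: "emeasure (distr ?G ?L (lp_normalize p n)) A =
      c * K * emeasure ?L (lp_ball p n \<inter> (lp_normalize p n -` A \<inter> space ?L))"
    if A [measurable]: "A \<in> sets ?L" for A
  proof -
    have "emeasure (distr ?G ?L (lp_normalize p n)) A = emeasure ?G (lp_normalize p n -` A \<inter> space ?L)"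
      using A by (subst emeasure_distr) (auto simp: sets_eq_imp_space_eq[OF sets_G])
    also have "\<dots> = (\<integral>\<^sup>+x. c * ennreal (exp (- (\<Sum>i<n. \<bar>x i\<bar> powr p) / p)) *
        indicator (lp_normalize p n -` A \<inter> space ?L) x \<partial>?L)"
      unfolding PiM_p_gaussian_eq_density[OF p] c_def by (rule emeasure_density) measurable
    also have "\<dots> = (\<integral>\<^sup>+x. c * (ennreal (exp (- (\<Sum>i<n. \<bar>x i\<bar> powr p) / p)) *
        indicator A (lp_normalize p n x)) \<partial>?L)"
      by (intro nn_integral_cong) (auto simp: mult.assoc split: split_indicator)
    also have "\<dots> = c * (K * emeasure ?L (lp_ball p n \<inter> (lp_normalize p n -` A \<inter> space ?L)))"
      by (subst nn_integral_cmult, measurable) (simp only: K[OF A])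
    finally show ?thesis by (simp add: mult.assoc)
  qed
  interpret G: prob_space ?G
    by (intro prob_space_PiM prob_space_p_gaussian p)
  interpret D: prob_space "distr ?G ?L (lp_normalize p n)"
    by (rule G.prob_space_distr) simp
  have "lp_normalize p n -` space ?L \<inter> space ?L = space ?L"
    using measurable_space[OF lp_normalize_measurable] by blast
  moreover have "lp_ball p n \<inter> space ?L = lp_ball p n" by (auto simp: lp_ball_def)
  ultimately have norm: "c * K * emeasure ?L (lp_ball p n) = 1"
    using em[of "space ?L"] D.emeasure_space_1 by simp
  have ball: "emeasure ?L (lp_ball p n) \<noteq> 0" "emeasure ?L (lp_ball p n) \<noteq> \<infinity>"
    using emeasure_lp_ball[OF p n] by auto
  have cK: "c * K = 1 / emeasure ?L (lp_ball p n)"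
    using norm ball by (metis ennreal_mult_divide_eq infinity_ennreal_def)
  show ?thesis
  proof (rule measure_eqI)
    show s: "sets (cone_measure p n) = sets (distr ?G ?L (lp_normalize p n))"
      unfolding cone_measure_eq_distr[OF p n] by simp
    fix A assume "A \<in> sets (cone_measure p n)"
    then have A [measurable]: "A \<in> sets ?L" using s by simp
    have "emeasure (cone_measure p n) A =
        emeasure ?L (lp_ball p n \<inter> (lp_normalize p n -` A \<inter> space ?L)) / emeasure ?L (lp_ball p n)"
      unfolding cone_measure_eq_distr[OF p n] by (subst emeasure_distr) auto
    also have "\<dots> = emeasure (distr ?G ?L (lp_normalize p n)) A"
      unfolding em[OF A] cK by (simp add: divide_ennreal_def mult.commute)
    finally show "emeasure (cone_measure p n) A = emeasure (distr ?G ?L (lp_normalize p n)) A" .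
  qed
qed

subsection \<open>Limit theorems for independent variables\<close>

text \<open>Each new summand is independent of the preceding sum and centred, so the cross term has
  expectation 0. It supplies the variance for Chebyshev's inequality.\<close>

lemma (in prob_space) expectation_square_indep_sum:
  fixes X :: "nat \<Rightarrow> 'a \<Rightarrow> real"
  assumes ind: "indep_vars (\<lambda>_. borel) X UNIV"
    and mean: "\<And>i. expectation (X i) = 0"
    and sq: "\<And>i. integrable M (\<lambda>\<omega>. (X i \<omega>)\<^sup>2)"
  shows "integrable M (\<lambda>\<omega>. (\<Sum>i<n. X i \<omega>)\<^sup>2) \<and>
    expectation (\<lambda>\<omega>. (\<Sum>i<n. X i \<omega>)\<^sup>2) = (\<Sum>i<n. expectation (\<lambda>\<omega>. (X i \<omega>)\<^sup>2))"
proof (induction n)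
  case (Suc n)
  have [measurable]: "X i \<in> borel_measurable M" for i
    using ind by (simp add: indep_vars_def2)
  have X: "integrable M (X i)" for i
    by (rule square_integrable_imp_integrable[OF _ sq]) simp
  have S: "integrable M (\<lambda>\<omega>. \<Sum>i<n. X i \<omega>)" "expectation (\<lambda>\<omega>. \<Sum>i<n. X i \<omega>) = 0"
    using X mean by auto
  have iv: "indep_var borel (X n) borel (\<lambda>\<omega>. \<Sum>i<n. X i \<omega>)"
    by (rule indep_vars_sum) (auto intro: indep_vars_subset[OF ind])
  have cross: "integrable M (\<lambda>\<omega>. X n \<omega> * (\<Sum>i<n. X i \<omega>))"
    "expectation (\<lambda>\<omega>. X n \<omega> * (\<Sum>i<n. X i \<omega>)) = 0"
    using indep_var_integrable[OF iv X S(1)] indep_var_lebesgue_integral[OF iv X S(1)] mean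
    by auto
  have eq: "(\<lambda>\<omega>. (\<Sum>i<Suc n. X i \<omega>)\<^sup>2) =
      (\<lambda>\<omega>. (\<Sum>i<n. X i \<omega>)\<^sup>2 + 2 * (X n \<omega> * (\<Sum>i<n. X i \<omega>)) + (X n \<omega>)\<^sup>2)"
    by (simp add: fun_eq_iff power2_eq_square algebra_simps)
  show ?case unfolding eq using Suc cross sq by simp
qed simp

text \<open>Slutsky's lemma for a limit with continuous distribution function. Outside an event of
  small probability, \<open>T n \<le> x\<close> is implied by
  \<open>W n \<le> x - \<epsilon>\<close> and implies \<open>W n \<le> x + \<epsilon>\<close>;
  continuity everywhere ensures convergence at both shifted points.\<close>

lemma (in prob_space) weak_conv_m_add_negligible:
  assumes [measurable]: "\<And>n. T n \<in> borel_measurable M" "\<And>n. W n \<in> borel_measurable M"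
    and conv: "weak_conv_m (\<lambda>n. distr M borel (W n)) \<mu>"
    and cont: "\<And>x. isCont (cdf \<mu>) x"
    and neg: "\<And>\<epsilon> \<delta>. \<epsilon> > 0 \<Longrightarrow> \<delta> > 0 \<Longrightarrow>
      \<forall>\<^sub>F n in sequentially. prob {\<omega> \<in> space M. \<bar>T n \<omega> - W n \<omega>\<bar> > \<epsilon>} \<le> \<delta>"
  shows "weak_conv_m (\<lambda>n. distr M borel (T n)) \<mu>"
  unfolding weak_conv_m_def weak_conv_def
proof (intro allI impI)
  fix x
  let ?F = "cdf \<mu>"
  have cdf_eq: "cdf (distr M borel V) y = prob {\<omega> \<in> space M. V \<omega> \<le> y}"
    if [measurable]: "V \<in> borel_measurable M" for V and y :: real
    by (simp add: cdf_def measure_distr vimage_def Int_def conj_commute)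
  have W: "(\<lambda>n. prob {\<omega> \<in> space M. W n \<omega> \<le> y}) \<longlonglongrightarrow> ?F y" for y
    using conv cont[of y] unfolding weak_conv_m_def weak_conv_def by (simp add: cdf_eq)
  show "(\<lambda>n. cdf (distr M borel (T n)) x) \<longlonglongrightarrow> ?F x"
    unfolding tendsto_iff
  proof (intro allI impI)
    fix r :: real assume r: "r > 0"
    \<comment> \<open>The budget \<open>r\<close> is split into three: continuity of the limit,
      convergence at a shifted point, and the exceptional event.\<close>
    obtain d where d: "d > 0" "\<And>y. \<bar>y - x\<bar> < d \<Longrightarrow> \<bar>?F y - ?F x\<bar> < r / 3"
      using cont[of x] r unfolding continuous_at_eps_delta by (force simp: dist_real_def dest: spec[of _ "r / 3"])
    define \<epsilon> where "\<epsilon> = d / 2"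
    have e: "\<epsilon> > 0" "\<bar>?F (x + \<epsilon>) - ?F x\<bar> < r / 3" "\<bar>?F (x - \<epsilon>) - ?F x\<bar> < r / 3"
      using d by (auto simp: \<epsilon>_def)
    have Wu: "\<forall>\<^sub>F n in sequentially. \<bar>prob {\<omega> \<in> space M. W n \<omega> \<le> x + \<epsilon>} - ?F (x + \<epsilon>)\<bar> < r / 3"
      by (rule tendstoD[OF W, unfolded dist_real_def]) (use r in simp)
    have Wl: "\<forall>\<^sub>F n in sequentially. \<bar>prob {\<omega> \<in> space M. W n \<omega> \<le> x - \<epsilon>} - ?F (x - \<epsilon>)\<bar> < r / 3"
      by (rule tendstoD[OF W, unfolded dist_real_def]) (use r in simp)
    have "\<forall>\<^sub>F n in sequentially. prob {\<omega> \<in> space M. \<bar>T n \<omega> - W n \<omega>\<bar> > \<epsilon>} \<le> r / 3"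
      using neg[OF e(1), of "r / 3"] r by simp
    with Wu Wl show "\<forall>\<^sub>F n in sequentially. dist (cdf (distr M borel (T n)) x) (?F x) < r"
    proof eventually_elim
      case (elim n)
      let ?D = "{\<omega> \<in> space M. \<bar>T n \<omega> - W n \<omega>\<bar> > \<epsilon>}"
      have "prob {\<omega> \<in> space M. T n \<omega> \<le> x} \<le> prob ({\<omega> \<in> space M. W n \<omega> \<le> x + \<epsilon>} \<union> ?D)"
        by (rule finite_measure_mono) auto
      also have "\<dots> \<le> prob {\<omega> \<in> space M. W n \<omega> \<le> x + \<epsilon>} + prob ?D"
        by (rule measure_Un_le) auto
      finally have u: "prob {\<omega> \<in> space M. T n \<omega> \<le> x} \<le> prob {\<omega> \<in> space M. W n \<omega> \<le> x + \<epsilon>} + prob ?D" .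
      have "prob {\<omega> \<in> space M. W n \<omega> \<le> x - \<epsilon>} \<le> prob ({\<omega> \<in> space M. T n \<omega> \<le> x} \<union> ?D)"
        by (rule finite_measure_mono) auto
      also have "\<dots> \<le> prob {\<omega> \<in> space M. T n \<omega> \<le> x} + prob ?D"
        by (rule measure_Un_le) auto
      finally have l: "prob {\<omega> \<in> space M. W n \<omega> \<le> x - \<epsilon>} \<le> prob {\<omega> \<in> space M. T n \<omega> \<le> x} + prob ?D" .
      show ?case
        using u l e elim unfolding cdf_eq[OF assms(1)] dist_real_def by linarith
    qed
  qed
qed

text \<open>Multiplication by \<open>c > 0\<close> replaces the argument of each distribution
  function by \<open>x / c\<close>, and continuity points are carried along by the dilation.\<close>

lemma weak_conv_m_scale:
  assumes conv: "weak_conv_m M N" and c: "c > 0"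
    and M: "\<And>n. sets (M n) = sets borel" and N: "sets N = sets borel"
  shows "weak_conv_m (\<lambda>n. distr (M n) borel (\<lambda>x. c * x)) (distr N borel (\<lambda>x. c * x))"
proof -
  have cdf_eq: "cdf (distr P borel (\<lambda>x. c * x)) x = cdf P (x / c)" if "sets P = sets borel" for P x
  proof -
    have [measurable_cong]: "sets P = sets borel" by fact
    have "(\<lambda>x. c * x) -` {..x} \<inter> space P = {..x / c}"
      using c sets_eq_imp_space_eq[OF that] by (auto simp: field_simps)
    then show ?thesis by (simp add: cdf_def measure_distr)
  qed
  show ?thesis
    unfolding weak_conv_m_def weak_conv_def cdf_eq[OF M] cdf_eq[OF N]
  proof (intro allI impI)
    fix x assume "isCont (\<lambda>x. cdf N (x / c)) x"
    then have "isCont (\<lambda>y. cdf N ((c * y) / c)) (x / c)"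
      using c by (intro isCont_o2[where f = "\<lambda>y. c * y" and g = "\<lambda>x. cdf N (x / c)"]) auto
    then have "isCont (cdf N) (x / c)" using c by simp
    then show "(\<lambda>n. cdf (M n) (x / c)) \<longlonglongrightarrow> cdf N (x / c)"
      using conv by (simp add: weak_conv_m_def weak_conv_def)
  qed
qed

lemma distr_std_normal_scale:
  assumes "\<sigma> > 0"
  shows "distr std_normal_distribution borel (\<lambda>x. \<sigma> * x) = density lborel (normal_density 0 \<sigma>)"
proof -
  interpret prob_space std_normal_distribution by (rule prob_space_normal_density) simp
  have "distributed std_normal_distribution lborel (\<lambda>x. x) (normal_density 0 1)"
    by (auto simp: distributed_def distr_id2)
  then have "distributed std_normal_distribution lborel (\<lambda>x. 0 + \<sigma> * x) (normal_density (0 + \<sigma> * 0) (\<bar>\<sigma>\<bar> * 1))"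
    by (rule normal_density_affine) (use assms in auto)
  then have "distr std_normal_distribution lborel (\<lambda>x. \<sigma> * x) = density lborel (normal_density 0 \<sigma>)"
    using assms by (simp add: distributed_def)
  then show ?thesis by (simp cong: distr_cong)
qed

text \<open>A distribution function is continuous where the measure has no atom, and a density with
  respect to Lebesgue measure excludes atoms.\<close>

lemma isCont_cdf_normal:
  assumes "\<sigma> > 0"
  shows "isCont (cdf (density lborel (normal_density \<mu> \<sigma>))) x"
proof -
  interpret prob_space "density lborel (normal_density \<mu> \<sigma>)"
    by (rule prob_space_normal_density[OF assms])
  interpret finite_borel_measure "density lborel (normal_density \<mu> \<sigma>)"
    by unfold_locales simp
  have "AE x' in lborel. x' \<in> {x} \<longrightarrow> ennreal (normal_density \<mu> \<sigma> x') = 0"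
    using AE_lborel_singleton[of x] by eventually_elim simp
  then have "{x} \<in> null_sets (density lborel (normal_density \<mu> \<sigma>))"
    by (subst null_sets_density_iff) auto
  then show ?thesis by (simp add: isCont_cdf measure_def null_sets_def)
qed

section \<open>Sums of iid coordinates on one infinite product space\<close>

context
  fixes \<mu> :: "real measure"
  assumes prob: "prob_space \<mu>" and sets_mu [measurable_cong]: "sets \<mu> = sets borel"
begin

interpretation mu: prob_space \<mu> by (rule prob)

interpretation iid: prob_space "PiM (UNIV :: nat set) (\<lambda>_. \<mu>)"
  by (intro prob_space_PiM prob)

lemma distr_iid_coordinate:
  assumes [measurable]: "g \<in> borel_measurable borel"
  shows "distr (PiM (UNIV :: nat set) (\<lambda>_. \<mu>)) borel (\<lambda>\<omega>. g (\<omega> i)) = distr \<mu> borel g"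
proof -
  have "distr \<mu> borel g = distr (distr (PiM (UNIV :: nat set) (\<lambda>_. \<mu>)) \<mu> (\<lambda>\<omega>. \<omega> i)) borel g"
    by (subst distr_PiM_component) (auto simp: prob)
  also have "\<dots> = distr (PiM (UNIV :: nat set) (\<lambda>_. \<mu>)) borel (\<lambda>\<omega>. g (\<omega> i))"
    by (subst distr_distr) (auto simp: comp_def)
  finally show ?thesis ..
qed

lemma
  fixes g :: "real \<Rightarrow> real"
  assumes g [measurable]: "g \<in> borel_measurable borel"
  shows expectation_iid_coordinate:
      "integral\<^sup>L (PiM (UNIV :: nat set) (\<lambda>_. \<mu>)) (\<lambda>\<omega>. g (\<omega> i)) = integral\<^sup>L \<mu> g"
    and integrable_iid_coordinate:
      "integrable (PiM (UNIV :: nat set) (\<lambda>_. \<mu>)) (\<lambda>\<omega>. g (\<omega> i)) = integrable \<mu> g"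
proof -
  let ?P = "PiM (UNIV :: nat set) (\<lambda>_. \<mu>)"
  have "integral\<^sup>L ?P (\<lambda>\<omega>. g (\<omega> i)) = integral\<^sup>L (distr ?P borel (\<lambda>\<omega>. g (\<omega> i))) (\<lambda>x. x)"
    by (subst integral_distr) auto
  also have "\<dots> = integral\<^sup>L \<mu> g"
    unfolding distr_iid_coordinate[OF g] by (subst integral_distr) auto
  finally show "integral\<^sup>L ?P (\<lambda>\<omega>. g (\<omega> i)) = integral\<^sup>L \<mu> g" .
  have "integrable ?P (\<lambda>\<omega>. g (\<omega> i)) = integrable (distr ?P borel (\<lambda>\<omega>. g (\<omega> i))) (\<lambda>x. x)"
    by (subst integrable_distr_eq) auto
  also have "\<dots> = integrable \<mu> g"
    unfolding distr_iid_coordinate[OF g] by (subst integrable_distr_eq) auto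
  finally show "integrable ?P (\<lambda>\<omega>. g (\<omega> i)) = integrable \<mu> g" .
qed

text \<open>The joint law of the coordinates is the product of their marginals, which characterises
  independence; functions of single coordinates inherit it.\<close>

lemma indep_vars_iid:
  fixes g :: "real \<Rightarrow> real"
  assumes [measurable]: "g \<in> borel_measurable borel"
  shows "iid.indep_vars (\<lambda>_. borel) (\<lambda>i \<omega>. g (\<omega> i)) (UNIV :: nat set)"
proof -
  let ?P = "PiM (UNIV :: nat set) (\<lambda>_. \<mu>)"
  have "iid.indep_vars (\<lambda>_. \<mu>) (\<lambda>i \<omega>. \<omega> i) (UNIV :: nat set)"
  proof (subst iid.indep_vars_iff_distr_eq_PiM)
    have "distr ?P ?P (\<lambda>\<omega>. \<lambda>i\<in>UNIV. \<omega> i) = ?P" by (simp add: restrict_UNIV distr_id2)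
    also have "\<dots> = PiM UNIV (\<lambda>i. distr ?P \<mu> (\<lambda>\<omega>. \<omega> i))"
      by (intro PiM_cong refl distr_PiM_component[symmetric]) (auto simp: prob)
    finally show "distr ?P ?P (\<lambda>\<omega>. \<lambda>i\<in>UNIV. \<omega> i) = PiM UNIV (\<lambda>i. distr ?P \<mu> (\<lambda>\<omega>. \<omega> i))" .
  qed auto
  then show ?thesis by (rule iid.indep_vars_compose2) auto
qed

text \<open>Chebyshev's inequality: the variance grows like \<open>n\<close>, so at scale
  \<open>sqrt n\<close> the bound is uniform in \<open>n\<close>.\<close>

lemma iid_sum_tail:
  fixes g :: "real \<Rightarrow> real"
  assumes g [measurable]: "g \<in> borel_measurable borel"
    and mean: "integral\<^sup>L \<mu> g = 0" and sq: "integrable \<mu> (\<lambda>x. (g x)\<^sup>2)" and K: "K > 0" and n: "n \<ge> 1"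
  shows "iid.prob {\<omega> \<in> space (PiM UNIV (\<lambda>_. \<mu>)). \<bar>\<Sum>i<n. g (\<omega> i)\<bar> \<ge> K * sqrt (real n)} \<le>
    integral\<^sup>L \<mu> (\<lambda>x. (g x)\<^sup>2) / K\<^sup>2"
proof -
  let ?P = "PiM (UNIV :: nat set) (\<lambda>_. \<mu>)" and ?S = "\<lambda>\<omega>. \<Sum>i<n. g (\<omega> i)"
  have g2 [measurable]: "(\<lambda>x. (g x)\<^sup>2) \<in> borel_measurable borel" by simp
  note ex = iid.expectation_square_indep_sum[OF indep_vars_iid[OF g], of n]
  have S2: "integrable ?P (\<lambda>\<omega>. (?S \<omega>)\<^sup>2)"
    "iid.expectation (\<lambda>\<omega>. (?S \<omega>)\<^sup>2) = real n * integral\<^sup>L \<mu> (\<lambda>x. (g x)\<^sup>2)"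
    using ex by (auto simp: expectation_iid_coordinate[OF g] expectation_iid_coordinate[OF g2]
        integrable_iid_coordinate[OF g2] mean sq)
  have "integrable \<mu> g" by (rule mu.square_integrable_imp_integrable[OF _ sq]) simp
  then have S1: "iid.expectation ?S = 0"
    by (subst Bochner_Integration.integral_sum)
       (auto simp: expectation_iid_coordinate[OF g] integrable_iid_coordinate[OF g] mean)
  have "iid.prob {\<omega> \<in> space ?P. \<bar>?S \<omega> - iid.expectation ?S\<bar> \<ge> K * sqrt (real n)} \<le>
      iid.variance ?S / (K * sqrt (real n))\<^sup>2"
    by (rule iid.Chebyshev_inequality) (use S2 K n in auto)
  then show ?thesis
    unfolding S1 using S2 n by (simp add: power_mult_distrib)
qed

lemma iid_sum_Markov:
  fixes g :: "real \<Rightarrow> real"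
  assumes g [measurable]: "g \<in> borel_measurable borel"
    and nonneg: "\<And>x. 0 \<le> g x" and int: "integrable \<mu> g" and K: "K > 0" and n: "n \<ge> 1"
  shows "iid.prob {\<omega> \<in> space (PiM UNIV (\<lambda>_. \<mu>)). (\<Sum>i<n. g (\<omega> i)) \<ge> K * real n} \<le> integral\<^sup>L \<mu> g / K"
proof -
  let ?P = "PiM (UNIV :: nat set) (\<lambda>_. \<mu>)" and ?S = "\<lambda>\<omega>. \<Sum>i<n. g (\<omega> i)"
  have S: "integrable ?P ?S" "iid.expectation ?S = real n * integral\<^sup>L \<mu> g"
    using int by (auto simp: expectation_iid_coordinate[OF g] integrable_iid_coordinate[OF g])
  have "iid.prob {\<omega> \<in> space ?P. ?S \<omega> \<ge> K * real n} \<le> iid.expectation ?S / (K * real n)"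
    by (rule integral_Markov_inequality_measure[where A = "space ?P"])
       (use S K n nonneg in \<open>auto simp: sum_nonneg\<close>)
  then show ?thesis using S n by simp
qed

lemma iid_central_limit:
  fixes g :: "real \<Rightarrow> real"
  assumes g [measurable]: "g \<in> borel_measurable borel"
    and mean: "integral\<^sup>L \<mu> g = 0" and sq: "integrable \<mu> (\<lambda>x. (g x)\<^sup>2)"
    and var: "integral\<^sup>L \<mu> (\<lambda>x. (g x)\<^sup>2) = \<sigma>\<^sup>2" and \<sigma>: "\<sigma> > 0"
  shows "weak_conv_m (\<lambda>n. distr (PiM UNIV (\<lambda>_. \<mu>)) borel (\<lambda>\<omega>. (\<Sum>i<n. g (\<omega> i)) / sqrt (real n)))
    (density lborel (normal_density 0 \<sigma>))"
proof -
  let ?P = "PiM (UNIV :: nat set) (\<lambda>_. \<mu>)"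
  have g2 [measurable]: "(\<lambda>x. (g x)\<^sup>2) \<in> borel_measurable borel" by simp
  have "weak_conv_m (\<lambda>n. distr ?P borel (\<lambda>\<omega>. (\<Sum>i<n. g (\<omega> i)) / sqrt (real n * \<sigma>\<^sup>2))) std_normal_distribution"
    by (rule iid.central_limit_theorem_zero_mean[OF indep_vars_iid[OF g] _ \<sigma>])
       (auto simp: expectation_iid_coordinate[OF g] expectation_iid_coordinate[OF g2]
         integrable_iid_coordinate[OF g2] mean sq var distr_iid_coordinate)
  from weak_conv_m_scale[OF this \<sigma>]
  have "weak_conv_m (\<lambda>n. distr (distr ?P borel (\<lambda>\<omega>. (\<Sum>i<n. g (\<omega> i)) / sqrt (real n * \<sigma>\<^sup>2))) borel (\<lambda>x. \<sigma> * x))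
      (density lborel (normal_density 0 \<sigma>))"
    unfolding distr_std_normal_scale[OF \<sigma>] by simp
  also have "(\<lambda>n. distr (distr ?P borel (\<lambda>\<omega>. (\<Sum>i<n. g (\<omega> i)) / sqrt (real n * \<sigma>\<^sup>2))) borel (\<lambda>x. \<sigma> * x)) =
      (\<lambda>n. distr ?P borel (\<lambda>\<omega>. (\<Sum>i<n. g (\<omega> i)) / sqrt (real n)))"
    using \<sigma> by (subst distr_distr) (auto simp: comp_def real_sqrt_mult)
  finally show ?thesis .
qed

end

subsection \<open>Moments of the p-Gaussian distribution\<close>

lemma p_gaussian_integrable_power:
  "1 \<le> p \<Longrightarrow> integrable (p_gaussian p) (\<lambda>x. (\<bar>x\<bar> powr p) ^ j)"
  using p_gaussian_moment by (auto simp: has_bochner_integral_iff)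

text \<open>The values 1 and \<open>1 + p\<close> at \<open>j = 1\<close> and \<open>j = 2\<close>
  are the centring constants used below.\<close>

lemma p_gaussian_integral_power:
  assumes "1 \<le> p"
  shows "integral\<^sup>L (p_gaussian p) (\<lambda>x. (\<bar>x\<bar> powr p) ^ j) = (\<Prod>i<j. 1 + real i * p)"
proof -
  have "integral\<^sup>L (p_gaussian p) (\<lambda>x. (\<bar>x\<bar> powr p) ^ j) = p ^ j * pochhammer (1 / p) j"
    using p_gaussian_moment[OF assms] by (auto simp: has_bochner_integral_iff)
  also have "\<dots> = (\<Prod>i<j. p * (1 / p + real i))"
    by (simp add: pochhammer_prod atLeast0LessThan prod.distrib)
  also have "\<dots> = (\<Prod>i<j. 1 + real i * p)"
    using assms by (intro prod.cong) (auto simp: field_simps)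
  finally show ?thesis .
qed

lemma p_gaussian_integrable_poly:
  assumes "1 \<le> p"
  shows "integrable (p_gaussian p) (\<lambda>x. poly q (\<bar>x\<bar> powr p))"
  unfolding poly_altdef
  by (intro Bochner_Integration.integrable_sum integrable_mult_right p_gaussian_integrable_power[OF assms])

text \<open>Every expectation below is that of a polynomial in \<open>|x|^p\<close>, so this formula
  reduces it to arithmetic in \<open>p\<close>.\<close>

lemma p_gaussian_integral_poly:
  assumes "1 \<le> p"
  shows "integral\<^sup>L (p_gaussian p) (\<lambda>x. poly q (\<bar>x\<bar> powr p)) =
    (\<Sum>j\<le>degree q. coeff q j * (\<Prod>i<j. 1 + real i * p))"
  unfolding poly_altdef
  by (subst Bochner_Integration.integral_sum)
     (auto intro!: p_gaussian_integrable_power[OF assms] simp: p_gaussian_integral_power[OF assms])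

text \<open>With \<open>Y = |x|^p\<close> this is
  \<open>(1 + p) * (Y - 1) - (Y^2 - (1 + p)) / 2\<close>, the linear part of \<open>- V / 2\<close>,
  after completing the square. The constant \<open>p * (1 + p)\<close> is the mean of the
  square.\<close>

definition maclaurin_summand :: "real \<Rightarrow> real \<Rightarrow> real" where
  "maclaurin_summand p x = - ((\<bar>x\<bar> powr p - 1 - p)\<^sup>2 - p * (1 + p)) / 2"

lemma maclaurin_summand_measurable [measurable]: "maclaurin_summand p \<in> borel_measurable borel"
  unfolding maclaurin_summand_def[abs_def] by measurable

lemma maclaurin_summand_eq_poly:
  "maclaurin_summand p x = poly [:- (1 + p) / 2, 1 + p, - 1 / 2:] (\<bar>x\<bar> powr p)"
  by (simp add: maclaurin_summand_def field_simps power2_eq_square)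

lemmas sum_prod_Suc_simps = numeral_eq_Suc atMost_Suc lessThan_Suc

lemma integral_maclaurin_summand:
  assumes p: "1 \<le> p"
  shows "integral\<^sup>L (p_gaussian p) (maclaurin_summand p) = 0"
  unfolding maclaurin_summand_eq_poly[abs_def] p_gaussian_integral_poly[OF p]
  by (simp add: sum_prod_Suc_simps field_simps)

lemma maclaurin_summand_square_eq_poly:
  "(maclaurin_summand p x)\<^sup>2 = poly ([:- (1 + p) / 2, 1 + p, - 1 / 2:]\<^sup>2) (\<bar>x\<bar> powr p)"
  by (simp add: maclaurin_summand_eq_poly)

lemma integrable_maclaurin_summand_square:
  "1 \<le> p \<Longrightarrow> integrable (p_gaussian p) (\<lambda>x. (maclaurin_summand p x)\<^sup>2)"
  unfolding maclaurin_summand_square_eq_poly by (rule p_gaussian_integrable_poly)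

lemma integral_maclaurin_summand_square:
  assumes p: "1 \<le> p"
  shows "integral\<^sup>L (p_gaussian p) (\<lambda>x. (maclaurin_summand p x)\<^sup>2) = rho_sq p"
proof -
  interpret prob_space "p_gaussian p" by (rule prob_space_p_gaussian[OF p])
  have eq: "(\<bar>x\<bar> powr p - 1 - p)\<^sup>2 = poly [:(1 + p)\<^sup>2, - 2 * (1 + p), 1:] (\<bar>x\<bar> powr p)" for x
    by (simp add: algebra_simps power2_eq_square)
  have "expectation (\<lambda>x. (\<bar>x\<bar> powr p - 1 - p)\<^sup>2) = p * (1 + p)"
    unfolding eq p_gaussian_integral_poly[OF p]
    by (simp add: sum_prod_Suc_simps algebra_simps)
  then have "rho_sq p = 1 / 4 * expectation (\<lambda>x. ((\<bar>x\<bar> powr p - 1 - p)\<^sup>2 - p * (1 + p))\<^sup>2)"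
    by (simp add: rho_sq_def)
  also have "\<dots> = expectation (\<lambda>x. 1 / 4 * ((\<bar>x\<bar> powr p - 1 - p)\<^sup>2 - p * (1 + p))\<^sup>2)"
    by (rule integral_mult_right_zero[symmetric])
  also have "\<dots> = expectation (\<lambda>x. (maclaurin_summand p x)\<^sup>2)"
    unfolding maclaurin_summand_def power_divide power2_minus by simp
  finally show ?thesis by simp
qed

text \<open>The closed form shows that the variance is strictly positive, as the central limit
  theorem demands.\<close>

lemma rho_sq_eq:
  assumes p: "1 \<le> p"
  shows "rho_sq p = p\<^sup>2 * (1 + p) / 2"
  unfolding integral_maclaurin_summand_square[OF p, symmetric] maclaurin_summand_square_eq_poly
    p_gaussian_integral_poly[OF p]
  by (simp add: sum_prod_Suc_simps field_simps)

subsection \<open>Reduction to the central limit theorem\<close>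

text \<open>The delta method with an explicit error. Here \<open>s\<close> is \<open>sqrt n\<close>,
  while \<open>a\<close> and \<open>b\<close> are the fluctuations of the first two empirical
  moments at scale \<open>s\<close>.\<close>

lemma scaled_variance_expansion:
  fixes a b K p s :: real
  assumes s: "1 \<le> s" and a: "\<bar>a\<bar> \<le> K" and b: "\<bar>b\<bar> \<le> K" and K: "0 \<le> K" and p: "0 \<le> p"
    and m: "1 / 2 \<le> 1 + a / s"
  shows "\<bar>s * ((1 + p + b / s) / (1 + a / s)\<^sup>2 - 1 - p) - (b - 2 * (1 + p) * a)\<bar> \<le>
    4 * ((K + 2 * (1 + p) * K) * K * (2 + K) + (1 + p) * K\<^sup>2) / s"
proof -
  define t where "t = 1 + a / s"
  define w where "w = b - 2 * (1 + p) * a"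
  have t: "1 / 2 \<le> t" using m by (simp add: t_def)
  have t2: "0 < t\<^sup>2" "1 / t\<^sup>2 \<le> 4"
  proof -
    have "(1 / 2)\<^sup>2 \<le> t\<^sup>2" using t by (intro power_mono) auto
    then show "0 < t\<^sup>2" "1 / t\<^sup>2 \<le> 4" by (auto simp: power2_eq_square field_simps)
  qed
  have "s * ((1 + p + b / s) / t\<^sup>2 - 1 - p) - w = - (w * a * (2 + a / s) + (1 + p) * a\<^sup>2) / s * (1 / t\<^sup>2)"
  proof -
    \<comment> \<open>Clearing denominators leaves a polynomial identity in which the first-order
      terms cancel by the choice of \<open>w\<close>. The later factor 4 is the bound for
      \<open>1 / t^2\<close>.\<close>
    have "s * s * ((1 + p + b / s) - (1 + p) * t\<^sup>2) - s * w * t\<^sup>2 = - (w * a * (2 + a / s) + (1 + p) * a\<^sup>2)"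
      using s unfolding t_def w_def by (simp add: field_simps power2_eq_square)
    then have "(s * ((1 + p + b / s) - (1 + p) * t\<^sup>2) - w * t\<^sup>2) * s = - (w * a * (2 + a / s) + (1 + p) * a\<^sup>2)"
      using s by (simp add: algebra_simps)
    then have "s * ((1 + p + b / s) - (1 + p) * t\<^sup>2) - w * t\<^sup>2 = - (w * a * (2 + a / s) + (1 + p) * a\<^sup>2) / s"
      using s by (subst eq_divide_eq) auto
    moreover have "s * ((1 + p + b / s) / t\<^sup>2 - 1 - p) - w = (s * ((1 + p + b / s) - (1 + p) * t\<^sup>2) - w * t\<^sup>2) * (1 / t\<^sup>2)"
      using t2 t by (simp add: diff_divide_distrib add_divide_distrib algebra_simps)
    ultimately show ?thesis by simp
  qed
  moreover have "\<bar>- (w * a * (2 + a / s) + (1 + p) * a\<^sup>2) / s * (1 / t\<^sup>2)\<bar> \<le>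
      ((K + 2 * (1 + p) * K) * K * (2 + K) + (1 + p) * K\<^sup>2) / s * 4"
  proof -
    have "\<bar>2 * (1 + p) * a\<bar> \<le> 2 * (1 + p) * K"
      using a p by (simp add: abs_mult mult_left_mono)
    then have w: "\<bar>w\<bar> \<le> K + 2 * (1 + p) * K" using b unfolding w_def by linarith
    have "\<bar>a / s\<bar> \<le> K / 1" unfolding abs_divide using a s K by (intro frac_le) auto
    then have as: "\<bar>2 + a / s\<bar> \<le> 2 + K" by linarith
    have "\<bar>w * a * (2 + a / s)\<bar> \<le> (K + 2 * (1 + p) * K) * K * (2 + K)"
      unfolding abs_mult[of "w * a"] abs_mult[of w] using w a as K p by (intro mult_mono) auto
    moreover have "\<bar>(1 + p) * a\<^sup>2\<bar> \<le> (1 + p) * K\<^sup>2"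
      using power_mono[OF a, of 2] p by (simp add: abs_mult mult_left_mono)
    ultimately have *: "\<bar>- (w * a * (2 + a / s) + (1 + p) * a\<^sup>2)\<bar> \<le> (K + 2 * (1 + p) * K) * K * (2 + K) + (1 + p) * K\<^sup>2"
      by linarith
    show ?thesis
      unfolding abs_mult[of _ "1 / t\<^sup>2"] abs_divide[of _ s]
      using * s t2 K p by (intro mult_mono divide_right_mono frac_le) auto
  qed
  ultimately show ?thesis unfolding t_def w_def by (simp add: mult.commute)
qed

text \<open>A pointwise statement: three inequalities on the sums force the statistic close to its
  linear part, so only the probability of violating them remains to be estimated.\<close>

lemma maclaurin_remainder_bound:
  assumes k: "1 \<le> k1" "k1 < k2" and p: "1 \<le> p" and K: "1 \<le> K"
  obtains C where "0 \<le> C"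
    "\<forall>\<^sub>F n in sequentially. \<forall>x.
      \<bar>\<Sum>i<n. \<bar>x i\<bar> powr p - 1\<bar> < K * sqrt (real n) \<longrightarrow>
      \<bar>\<Sum>i<n. (\<bar>x i\<bar> powr p)\<^sup>2 - (1 + p)\<bar> < K * sqrt (real n) \<longrightarrow>
      (\<Sum>i<n. (2 * \<bar>x i\<bar> powr p + 1) ^ k2) < K * real n \<longrightarrow>
      \<bar>sqrt (real n) * (real n * p / (real k2 - real k1) *
          (maclaurin_ratio k1 k2 p n (lp_normalize p n x) - 1) + p / 2) -
        (\<Sum>i<n. maclaurin_summand p (x i)) / sqrt (real n)\<bar> \<le> C / sqrt (real n)"
proof -
  obtain D where D: "0 \<le> D" and ev: "\<forall>\<^sub>F n in sequentially. \<forall>z c x. moments_bdd K k2 n z \<longrightarrow> 0 < c \<longrightarrow>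
      (\<forall>i<n. \<bar>x i\<bar> powr p = c * (1 + z i)) \<longrightarrow>
      \<bar>real n * p / (real k2 - real k1) * (maclaurin_ratio k1 k2 p n x - 1) +
        (\<Sum>i<n. (z i)\<^sup>2) / real n / 2\<bar> \<le> D / real n"
    using maclaurin_ratio_expansion[OF K k p] by blast
  define H where "H = 4 * ((K + 2 * (1 + p) * K) * K * (2 + K) + (1 + p) * K\<^sup>2)"
  have H: "0 \<le> H" using K p by (simp add: H_def)
  have "\<forall>\<^sub>F n in sequentially. real n \<ge> max 1 ((2 * K)\<^sup>2)"
    by (rule eventually_compose_filterlim[OF eventually_ge_at_top filterlim_real_sequentially])
  with ev have "\<forall>\<^sub>F n in sequentially. \<forall>x.
      \<bar>\<Sum>i<n. \<bar>x i\<bar> powr p - 1\<bar> < K * sqrt (real n) \<longrightarrow>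
      \<bar>\<Sum>i<n. (\<bar>x i\<bar> powr p)\<^sup>2 - (1 + p)\<bar> < K * sqrt (real n) \<longrightarrow>
      (\<Sum>i<n. (2 * \<bar>x i\<bar> powr p + 1) ^ k2) < K * real n \<longrightarrow>
      \<bar>sqrt (real n) * (real n * p / (real k2 - real k1) *
          (maclaurin_ratio k1 k2 p n (lp_normalize p n x) - 1) + p / 2) -
        (\<Sum>i<n. maclaurin_summand p (x i)) / sqrt (real n)\<bar> \<le> (D + H) / sqrt (real n)"
  proof eventually_elim
    case (elim n)
    show ?case
    proof (intro allI impI)
      fix x :: "nat \<Rightarrow> real"
      define Y where "Y i = \<bar>x i\<bar> powr p" for i
      define s where "s = sqrt (real n)"
      define a where "a = (\<Sum>i<n. Y i - 1) / s"
      define b where "b = (\<Sum>i<n. (Y i)\<^sup>2 - (1 + p)) / s"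
      define m where "m = 1 + a / s"
      define z where "z i = Y i / m - 1" for i
      define V where "V = (\<Sum>i<n. (z i)\<^sup>2) / real n"
      define R where "R = maclaurin_ratio k1 k2 p n (lp_normalize p n x) - 1"
      assume A: "\<bar>\<Sum>i<n. \<bar>x i\<bar> powr p - 1\<bar> < K * sqrt (real n)"
        and B: "\<bar>\<Sum>i<n. (\<bar>x i\<bar> powr p)\<^sup>2 - (1 + p)\<bar> < K * sqrt (real n)"
        and M: "(\<Sum>i<n. (2 * \<bar>x i\<bar> powr p + 1) ^ k2) < K * real n"
      have n: "real n \<ge> 1" "real n \<ge> (2 * K)\<^sup>2" using elim(2) by auto
      have s: "s \<ge> 1" "s * s = real n" using n by (auto simp: s_def)
      \<comment> \<open>The threshold \<open>(2 * K)^2\<close> for \<open>n\<close> keeps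
        \<open>a / s\<close> within 1/2. Hence \<open>m \<ge> 1 / 2\<close> and
        \<open>Y i / m \<le> 2 * Y i\<close>, which is why the third hypothesis concerns powers of
        \<open>2 * Y i + 1\<close>.\<close>
      have sK: "s \<ge> 2 * K" using n(2) unfolding s_def by (rule real_le_rsqrt)
      have a: "\<bar>a\<bar> \<le> K" using A s unfolding a_def Y_def by (simp add: s_def field_simps)
      have b: "\<bar>b\<bar> \<le> K" using B s unfolding b_def Y_def by (simp add: s_def field_simps)
      have "\<bar>a / s\<bar> \<le> 1 / 2" using a sK s by (simp add: field_simps)
      then have m: "1 / 2 \<le> m" unfolding m_def by linarith
      have Y: "Y i \<ge> 0" for i by (simp add: Y_def)
      have sumY: "(\<Sum>i<n. Y i) = real n * m"
      proof -
        have "real n * m = real n + (\<Sum>i<n. Y i - 1)"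
          using s by (simp add: m_def a_def distrib_left flip: s(2))
        then show ?thesis by (simp add: sum_subtractf)
      qed
      have sumY2: "(\<Sum>i<n. (Y i)\<^sup>2) = real n * (1 + p + b / s)"
      proof -
        have "real n * (1 + p + b / s) = real n * (1 + p) + (\<Sum>i<n. (Y i)\<^sup>2 - (1 + p))"
          using s by (simp add: b_def algebra_simps flip: s(2))
        then show ?thesis by (simp add: sum_subtractf)
      qed
      have sum_z: "(\<Sum>i<n. z i) = 0"
        using m sumY by (simp add: z_def sum_subtractf flip: sum_divide_distrib)
      have V: "V = (1 + p + b / s) / m\<^sup>2 - 1"
      proof -
        have "(\<Sum>i<n. (z i)\<^sup>2) = (\<Sum>i<n. (Y i)\<^sup>2 / m\<^sup>2 - 2 / m * Y i + 1)"
          by (intro sum.cong refl) (simp add: z_def power2_diff power_divide)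
        also have "\<dots> = (\<Sum>i<n. (Y i)\<^sup>2) / m\<^sup>2 - 2 / m * (\<Sum>i<n. Y i) + real n"
          by (simp add: sum.distrib sum_subtractf sum_divide_distrib sum_distrib_left)
        also have "\<dots> = real n * ((1 + p + b / s) / m\<^sup>2 - 1)"
          unfolding sumY sumY2 using m by (simp add: algebra_simps)
        finally show ?thesis using n by (simp add: V_def)
      qed
      have mb: "moments_bdd K k2 n z"
        unfolding moments_bdd_def
      proof (intro conjI ballI sum_z)
        fix j assume j: "j \<in> {2..k2}"
        have "\<bar>z i ^ j\<bar> \<le> (2 * Y i + 1) ^ k2" for i
        proof -
          have "Y i / m \<le> Y i / (1 / 2)" using m Y by (intro divide_left_mono) auto
          then have "Y i / m \<le> 2 * Y i" by simp
          moreover have "0 \<le> Y i / m" using Y m by (intro divide_nonneg_nonneg) auto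
          ultimately have "\<bar>z i\<bar> \<le> 2 * Y i + 1" using Y[of i] unfolding z_def by linarith
          then have "\<bar>z i ^ j\<bar> \<le> (2 * Y i + 1) ^ j"
            unfolding power_abs by (intro power_mono) auto
          also have "\<dots> \<le> (2 * Y i + 1) ^ k2"
            using j Y[of i] by (intro power_increasing) auto
          finally show ?thesis .
        qed
        then have "\<bar>\<Sum>i<n. z i ^ j\<bar> \<le> (\<Sum>i<n. (2 * Y i + 1) ^ k2)"
          by (intro order_trans[OF sum_abs] sum_mono)
        then show "\<bar>\<Sum>i<n. z i ^ j\<bar> \<le> K * real n" using M by (simp add: Y_def)
      qed
      \<comment> \<open>The p-th power of the norm is \<open>n * m\<close>, so the point on the
        sphere has the form required by the expansion with scale \<open>c = 1 / n\<close>.\<close>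
      have norm: "\<bar>lp_normalize p n x i\<bar> powr p = 1 / real n * (1 + z i)" if "i < n" for i
      proof -
        have "\<bar>lp_normalize p n x i\<bar> powr p = Y i / lp_norm p n x powr p"
          using that lp_norm_nonneg[of p n x] by (simp add: lp_normalize_def powr_divide Y_def)
        also have "lp_norm p n x powr p = real n * m"
          unfolding sum_powr_eq_lp_norm_powr[OF p, symmetric] sumY[symmetric] Y_def ..
        finally show ?thesis by (simp add: z_def)
      qed
      have "\<bar>real n * p / (real k2 - real k1) * R + V / 2\<bar> \<le> D / real n"
        unfolding R_def V_def
        by (rule elim(1)[rule_format, where c = "1 / real n"]) (use mb norm n in auto)
      then have 1: "s * \<bar>real n * p / (real k2 - real k1) * R + V / 2\<bar> \<le> s * (D / real n)"
        using s by (intro mult_left_mono) auto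
      have "s * (D / real n) = D / s" using s by (simp flip: s(2))
      with 1 have 1: "\<bar>s * (real n * p / (real k2 - real k1) * R + V / 2)\<bar> \<le> D / s"
        using s by (simp add: abs_mult)
      have 2: "\<bar>s * (V - p) - (b - 2 * (1 + p) * a)\<bar> \<le> H / s"
        unfolding V H_def m_def
        by (rule scaled_variance_expansion[OF s(1) a b]) (use m p K in \<open>auto simp: m_def\<close>)
      have W: "(\<Sum>i<n. maclaurin_summand p (x i)) / s = - (b - 2 * (1 + p) * a) / 2"
      proof -
        have "(\<Sum>i<n. maclaurin_summand p (x i)) =
            (\<Sum>i<n. (1 + p) * (Y i - 1) - ((Y i)\<^sup>2 - (1 + p)) / 2)"
          by (intro sum.cong refl) (simp add: maclaurin_summand_def Y_def field_simps power2_eq_square)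
        also have "\<dots> = (1 + p) * (\<Sum>i<n. Y i - 1) - (\<Sum>i<n. (Y i)\<^sup>2 - (1 + p)) / 2"
          unfolding sum_distrib_left sum_divide_distrib by (rule sum_subtractf)
        also have "\<dots> = (1 + p) * (a * s) - b * s / 2" using s by (simp add: a_def b_def)
        also have "\<dots> = - (b - 2 * (1 + p) * a) / 2 * s" by algebra
        finally show ?thesis using s by simp
      qed
      \<comment> \<open>The error splits into that of the ratio expansion (\<open>D\<close>) and
        half of that of the delta method (\<open>H\<close>).\<close>
      have "s * (real n * p / (real k2 - real k1) * R + p / 2) - (\<Sum>i<n. maclaurin_summand p (x i)) / s =
          s * (real n * p / (real k2 - real k1) * R + V / 2) -
          (s * (V - p) - (b - 2 * (1 + p) * a)) / 2"
        unfolding W by (simp add: field_simps)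
      also have "\<bar>\<dots>\<bar> \<le> D / s + H / s"
      proof -
        have "\<bar>q - r / 2\<bar> \<le> u + v" if "\<bar>q\<bar> \<le> u" "\<bar>r\<bar> \<le> v" for q r u v :: real
          using that by linarith
        from this[OF 1 2] show ?thesis .
      qed
      finally show "\<bar>sqrt (real n) * (real n * p / (real k2 - real k1) *
          (maclaurin_ratio k1 k2 p n (lp_normalize p n x) - 1) + p / 2) -
        (\<Sum>i<n. maclaurin_summand p (x i)) / sqrt (real n)\<bar> \<le> (D + H) / sqrt (real n)"
        by (simp add: R_def s_def add_divide_distrib)
    qed
  qed
  moreover have "0 \<le> D + H" using D H by simp
  ultimately show thesis using that by blast
qed

lemma maclaurin_ratio_measurable [measurable]:
  "maclaurin_ratio k1 k2 p n \<in> borel_measurable (lborel_n n)"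
proof -
  have comp [measurable]: "(\<lambda>x. x i) \<in> borel_measurable (lborel_n n)" if "i \<in> {..<n}" for i
    using measurable_component_singleton[OF that, of "\<lambda>_. lborel"] by (simp add: lborel_n_def)
  have "maclaurin_mean k p n \<in> borel_measurable (lborel_n n)" for k
    unfolding maclaurin_mean_def[abs_def]
    by (intro powr_real_measurable borel_measurable_divide borel_measurable_sum borel_measurable_prod
        borel_measurable_abs comp borel_measurable_const) auto
  then show ?thesis unfolding maclaurin_ratio_def[abs_def] by (intro borel_measurable_divide)
qed

text \<open>A single infinite sequence serves all dimensions. It is restricted to
  \<open>{..<n}\<close> because points of \<open>lborel_n n\<close> are extensional.\<close>

lemma maclaurin_ratio_iid_weak_conv:
  assumes k: "1 \<le> k1" "k1 < k2" and p: "1 \<le> p"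
  shows "weak_conv_m
    (\<lambda>n. distr (PiM UNIV (\<lambda>_. p_gaussian p)) borel
      (\<lambda>\<omega>. sqrt (real n) * (real n * p / (real k2 - real k1) *
        (maclaurin_ratio k1 k2 p n (lp_normalize p n (restrict \<omega> {..<n})) - 1) + p / 2)))
    (density lborel (normal_density 0 (sqrt (rho_sq p))))"
proof -
  let ?P = "PiM (UNIV :: nat set) (\<lambda>_. p_gaussian p)"
  note G = prob_space_p_gaussian[OF p] sets_p_gaussian
  interpret prob_space ?P by (intro prob_space_PiM G)
  have rho: "sqrt (rho_sq p) > 0" "(sqrt (rho_sq p))\<^sup>2 = rho_sq p"
    using p by (auto simp: rho_sq_eq)
  define W where "W n \<omega> = (\<Sum>i<n. maclaurin_summand p (\<omega> i)) / sqrt (real n)" for n and \<omega> :: "nat \<Rightarrow> real"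
  define T where "T n \<omega> = sqrt (real n) * (real n * p / (real k2 - real k1) *
        (maclaurin_ratio k1 k2 p n (lp_normalize p n (restrict \<omega> {..<n})) - 1) + p / 2)"
    for n and \<omega> :: "nat \<Rightarrow> real"
  have restr [measurable]: "(\<lambda>\<omega>. restrict \<omega> {..<n}) \<in> measurable ?P (lborel_n n)" for n
    unfolding measurable_cong_sets[OF refl sets_lborel_n]
    by (intro measurable_restrict) (auto intro: measurable_compose[OF measurable_component_singleton])
  have [measurable]: "W n \<in> borel_measurable ?P" for n
    unfolding W_def[abs_def] by measurable
  have [measurable]: "T n \<in> borel_measurable ?P" for n
    unfolding T_def[abs_def] by measurable
  have "weak_conv_m (\<lambda>n. distr ?P borel (T n)) (density lborel (normal_density 0 (sqrt (rho_sq p))))"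
  proof (rule weak_conv_m_add_negligible)
    show "weak_conv_m (\<lambda>n. distr ?P borel (W n)) (density lborel (normal_density 0 (sqrt (rho_sq p))))"
      unfolding W_def
      by (rule iid_central_limit[OF G])
         (use p rho in \<open>auto simp: integral_maclaurin_summand integrable_maclaurin_summand_square
            integral_maclaurin_summand_square\<close>)
    show "isCont (cdf (density lborel (normal_density 0 (sqrt (rho_sq p))))) x" for x
      by (rule isCont_cdf_normal[OF rho(1)])
    fix \<epsilon> \<delta> :: real assume ed: "\<epsilon> > 0" "\<delta> > 0"
    \<comment> \<open>\<open>g1\<close> and \<open>g2\<close> are centred, so their sums are
      controlled at scale \<open>sqrt n\<close>; the sum of the nonnegative \<open>g3\<close> is
      controlled at scale \<open>n\<close>.\<close>
    define g1 where "g1 x = \<bar>x\<bar> powr p - 1" for x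
    define g2 where "g2 x = (\<bar>x\<bar> powr p)\<^sup>2 - (1 + p)" for x
    define g3 where "g3 x = (2 * \<bar>x\<bar> powr p + 1) ^ k2" for x
    have [measurable]: "g1 \<in> borel_measurable borel" "g2 \<in> borel_measurable borel" "g3 \<in> borel_measurable borel"
      unfolding g1_def[abs_def] g2_def[abs_def] g3_def[abs_def] by measurable
    have poly: "g1 = (\<lambda>x. poly [:-1, 1:] (\<bar>x\<bar> powr p))" "g2 = (\<lambda>x. poly [:- (1 + p), 0, 1:] (\<bar>x\<bar> powr p))"
      "g3 = (\<lambda>x. poly ([:1, 2:] ^ k2) (\<bar>x\<bar> powr p))"
      by (auto simp: fun_eq_iff g1_def g2_def g3_def power2_eq_square ac_simps)
    have mean: "integral\<^sup>L (p_gaussian p) g1 = 0" "integral\<^sup>L (p_gaussian p) g2 = 0"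
      unfolding poly p_gaussian_integral_poly[OF p] by (simp_all add: sum_prod_Suc_simps)
    have int3: "integrable (p_gaussian p) g3"
      unfolding poly by (rule p_gaussian_integrable_poly[OF p])
    have sq: "integrable (p_gaussian p) (\<lambda>x. (g1 x)\<^sup>2)" "integrable (p_gaussian p) (\<lambda>x. (g2 x)\<^sup>2)"
      unfolding poly poly_power[symmetric] by (rule p_gaussian_integrable_poly[OF p])+
    have g3_nonneg: "0 \<le> g3 x" for x by (simp add: g3_def)
    define c1 where "c1 = integral\<^sup>L (p_gaussian p) (\<lambda>x. (g1 x)\<^sup>2)"
    define c2 where "c2 = integral\<^sup>L (p_gaussian p) (\<lambda>x. (g2 x)\<^sup>2)"
    define c3 where "c3 = integral\<^sup>L (p_gaussian p) g3"
    have c: "c1 \<ge> 0" "c2 \<ge> 0" "c3 \<ge> 0"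
      unfolding c1_def c2_def c3_def by (auto intro!: integral_nonneg simp: g3_nonneg)
    \<comment> \<open>Chebyshev contributes \<open>c1 / K^2\<close> and \<open>c2 / K^2\<close>,
      Markov contributes \<open>c3 / K\<close>. Since \<open>K \<ge> 1\<close>, the total is at most
      \<open>(c1 + c2 + c3) / K\<close>.\<close>
    define K where "K = max 1 ((c1 + c2 + c3) / \<delta>)"
    have K: "K \<ge> 1" "(c1 + c2 + c3) / \<delta> \<le> K" by (auto simp: K_def)
    have Kd: "c1 / K\<^sup>2 + c2 / K\<^sup>2 + c3 / K \<le> \<delta>"
    proof -
      have "K \<le> K\<^sup>2" using K by (simp add: power2_eq_square)
      then have "c1 / K\<^sup>2 \<le> c1 / K" "c2 / K\<^sup>2 \<le> c2 / K" using c K by (auto intro!: divide_left_mono)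
      moreover have "(c1 + c2 + c3) / K \<le> \<delta>" using K ed by (simp add: field_simps)
      ultimately show ?thesis by (simp add: add_divide_distrib)
    qed
    obtain C where C: "0 \<le> C" and ev: "\<forall>\<^sub>F n in sequentially. \<forall>x.
      \<bar>\<Sum>i<n. \<bar>x i\<bar> powr p - 1\<bar> < K * sqrt (real n) \<longrightarrow>
      \<bar>\<Sum>i<n. (\<bar>x i\<bar> powr p)\<^sup>2 - (1 + p)\<bar> < K * sqrt (real n) \<longrightarrow>
      (\<Sum>i<n. (2 * \<bar>x i\<bar> powr p + 1) ^ k2) < K * real n \<longrightarrow>
      \<bar>sqrt (real n) * (real n * p / (real k2 - real k1) *
          (maclaurin_ratio k1 k2 p n (lp_normalize p n x) - 1) + p / 2) -
        (\<Sum>i<n. maclaurin_summand p (x i)) / sqrt (real n)\<bar> \<le> C / sqrt (real n)"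
      using maclaurin_remainder_bound[OF k p K(1)] by blast
    have "(\<lambda>n. C / sqrt (real n)) \<longlonglongrightarrow> 0" by real_asymp
    then have "\<forall>\<^sub>F n in sequentially. C / sqrt (real n) < \<epsilon>"
      using ed by (intro order_tendstoD) auto
    with ev eventually_ge_at_top[of 1]
    show "\<forall>\<^sub>F n in sequentially. prob {\<omega> \<in> space ?P. \<bar>T n \<omega> - W n \<omega>\<bar> > \<epsilon>} \<le> \<delta>"
    proof eventually_elim
      case (elim n)
      let ?E1 = "{\<omega> \<in> space ?P. \<bar>\<Sum>i<n. g1 (\<omega> i)\<bar> \<ge> K * sqrt (real n)}"
      let ?E2 = "{\<omega> \<in> space ?P. \<bar>\<Sum>i<n. g2 (\<omega> i)\<bar> \<ge> K * sqrt (real n)}"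
      let ?E3 = "{\<omega> \<in> space ?P. (\<Sum>i<n. g3 (\<omega> i)) \<ge> K * real n}"
      have "{\<omega> \<in> space ?P. \<bar>T n \<omega> - W n \<omega>\<bar> > \<epsilon>} \<subseteq> ?E1 \<union> ?E2 \<union> ?E3"
      proof (intro subsetI, rule ccontr)
        fix \<omega> assume w: "\<omega> \<in> {\<omega> \<in> space ?P. \<bar>T n \<omega> - W n \<omega>\<bar> > \<epsilon>}" and "\<omega> \<notin> ?E1 \<union> ?E2 \<union> ?E3"
        \<comment> \<open>The sums run over \<open>i < n\<close> only, where the restricted sequence
          agrees with the original one.\<close>
        then have "\<bar>T n \<omega> - W n \<omega>\<bar> \<le> C / sqrt (real n)"
          using elim(1)[rule_format, of "restrict \<omega> {..<n}"]
          by (auto simp: T_def W_def g1_def g2_def g3_def not_le)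
        with elim w show False by auto
      qed
      then have "prob {\<omega> \<in> space ?P. \<bar>T n \<omega> - W n \<omega>\<bar> > \<epsilon>} \<le> prob (?E1 \<union> ?E2 \<union> ?E3)"
        by (rule finite_measure_mono) measurable
      also have "\<dots> \<le> prob (?E1 \<union> ?E2) + prob ?E3" by (rule measure_Un_le) measurable
      also have "prob (?E1 \<union> ?E2) \<le> prob ?E1 + prob ?E2" by (rule measure_Un_le) measurable
      also have "prob ?E1 \<le> c1 / K\<^sup>2"
        unfolding c1_def by (rule iid_sum_tail[OF G]) (use K elim mean sq in auto)
      also have "prob ?E2 \<le> c2 / K\<^sup>2"
        unfolding c2_def by (rule iid_sum_tail[OF G]) (use K elim mean sq in auto)
      also have "prob ?E3 \<le> c3 / K"
        unfolding c3_def by (rule iid_sum_Markov[OF G]) (use K elim int3 in \<open>auto simp: g3_nonneg\<close>)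
      finally show ?case using Kd by simp
    qed
  qed measurable
  then show ?thesis unfolding T_def[abs_def] .
qed

theorem theorem3:
  fixes k1 k2 :: nat and p :: real
    and M :: "nat \<Rightarrow> 'a measure" and X :: "nat \<Rightarrow> 'a \<Rightarrow> nat \<Rightarrow> real"
  assumes "1 \<le> k1" and "k1 < k2" and "1 \<le> p"
    and "\<And>n. k2 \<le> n \<Longrightarrow> prob_space (M n)"
    and "\<And>n. k2 \<le> n \<Longrightarrow> X n \<in> measurable (M n) (lborel_n n)"
    and "\<And>n. k2 \<le> n \<Longrightarrow> distr (M n) (lborel_n n) (X n) = cone_measure p n"
  shows "weak_conv_m
           (\<lambda>n. distr (M n) borel
              (\<lambda>\<omega>. sqrt (real n) *
                 (real n * p / (real k2 - real k1) * (maclaurin_ratio k1 k2 p n (X n \<omega>) - 1) + p / 2)))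
           (density lborel (normal_density 0 (sqrt (rho_sq p))))"
proof -
  let ?P = "PiM (UNIV :: nat set) (\<lambda>_. p_gaussian p)"
  define F where "F n x = sqrt (real n) *
      (real n * p / (real k2 - real k1) * (maclaurin_ratio k1 k2 p n x - 1) + p / 2)" for n x
  have F [measurable]: "F n \<in> borel_measurable (lborel_n n)" for n
    unfolding F_def[abs_def] by measurable
  interpret G: prob_space "p_gaussian p" by (rule prob_space_p_gaussian[OF assms(3)])
  interpret product_prob_space "\<lambda>_. p_gaussian p" "UNIV :: nat set" ..
  \<comment> \<open>Weak convergence depends on the laws alone, so for each \<open>n\<close> the
    given space may be exchanged for the common product space.\<close>
  have eq: "distr (M n) borel (\<lambda>\<omega>. F n (X n \<omega>)) = distr ?P borel (\<lambda>\<omega>. F n (lp_normalize p n (restrict \<omega> {..<n})))"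
    if n: "k2 \<le> n" for n
  proof -
    let ?Q = "PiM {..<n} (\<lambda>_. p_gaussian p)"
    have sets_Q: "sets ?Q = sets (lborel_n n)"
      unfolding sets_lborel_n by (rule sets_PiM_cong) auto
    have norm: "lp_normalize p n \<in> measurable ?Q (lborel_n n)"
      using lp_normalize_measurable[of p n] by (simp add: measurable_cong_sets[OF sets_Q refl])
    have restr: "(\<lambda>\<omega>. restrict \<omega> {..<n}) \<in> measurable ?P ?Q"
      by (rule measurable_restrict_subset) simp
    have FN: "(\<lambda>x. F n (lp_normalize p n x)) \<in> borel_measurable ?Q"
      using measurable_compose[OF norm F] .
    have "distr (M n) borel (\<lambda>\<omega>. F n (X n \<omega>)) = distr (distr (M n) (lborel_n n) (X n)) borel (F n)"
      using assms(5)[OF n] by (subst distr_distr) (auto simp: comp_def)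
    also have "distr (M n) (lborel_n n) (X n) = distr ?Q (lborel_n n) (lp_normalize p n)"
      using assms(1,2) n unfolding assms(6)[OF n] by (intro cone_measure_eq_distr_p_gaussian assms(3)) auto
    also have "distr \<dots> borel (F n) = distr ?Q borel (\<lambda>x. F n (lp_normalize p n x))"
      using norm by (subst distr_distr) (auto simp: comp_def)
    also have "?Q = distr ?P ?Q (\<lambda>\<omega>. restrict \<omega> {..<n})"
      by (rule distr_PiM_restrict_finite[symmetric]) auto
    also have "distr \<dots> borel (\<lambda>x. F n (lp_normalize p n x)) =
        distr ?P borel (\<lambda>\<omega>. F n (lp_normalize p n (restrict \<omega> {..<n})))"
      using FN restr by (subst distr_distr) (auto simp: comp_def)
    finally show ?thesis .
  qed
  have lim: "weak_conv_m (\<lambda>n. distr ?P borel (\<lambda>\<omega>. F n (lp_normalize p n (restrict \<omega> {..<n}))))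
      (density lborel (normal_density 0 (sqrt (rho_sq p))))"
    unfolding F_def using assms by (intro maclaurin_ratio_iid_weak_conv)
  have "weak_conv_m (\<lambda>n. distr (M n) borel (\<lambda>\<omega>. F n (X n \<omega>))) (density lborel (normal_density 0 (sqrt (rho_sq p))))"
    unfolding weak_conv_m_def weak_conv_def
  proof (intro allI impI)
    fix x assume "isCont (cdf (density lborel (normal_density 0 (sqrt (rho_sq p))))) x"
    with lim have "(\<lambda>n. cdf (distr ?P borel (\<lambda>\<omega>. F n (lp_normalize p n (restrict \<omega> {..<n})))) x)
        \<longlonglongrightarrow> cdf (density lborel (normal_density 0 (sqrt (rho_sq p)))) x"
      unfolding weak_conv_m_def weak_conv_def by blast
    \<comment> \<open>Nothing is assumed about the finitely many dimensions below \<open>k2\<close>,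
      so the distribution functions are identified only eventually.\<close>
    moreover have "\<forall>\<^sub>F n in sequentially. cdf (distr (M n) borel (\<lambda>\<omega>. F n (X n \<omega>))) x =
        cdf (distr ?P borel (\<lambda>\<omega>. F n (lp_normalize p n (restrict \<omega> {..<n})))) x"
      using eventually_ge_at_top[of k2] by eventually_elim (simp add: eq)
    ultimately show "(\<lambda>n. cdf (distr (M n) borel (\<lambda>\<omega>. F n (X n \<omega>))) x)
        \<longlonglongrightarrow> cdf (density lborel (normal_density 0 (sqrt (rho_sq p)))) x"
      using tendsto_cong by fastforce
  qed
  then show ?thesis unfolding F_def .
qed

end
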